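(* Assume Hypothesis A (stated in the context) and let $\varphi\in C^{2}(I)$ be the solution of the initial value problem $$\varepsilon^2\varphi''(x)+a(x)\varphi(x)=0,\quad x\in I=[\xi,\eta],\qquad \varphi(\xi)=\varphi_0,\qquad \varepsilon\varphi'(\xi)=\varphi_1 .$$ Let $\varphi_N^{WKB}$ be the WKB approximation defined in the context. Then there exist $\tilde{\varepsilon}_{0}\in(0,1)$ and $N=N(\varepsilon)\in \mathbb{N}$ such that for $\varepsilon\in(0,\tilde{\varepsilon}_{0}]$ it holds $$\lVert \varphi-\varphi_{N}^{WKB}\rVert_{L^{\infty}(I)} \leq C\exp\left(-\frac{r}{\varepsilon}\right),$$ with constants $C,r>0$ independent of $\varepsilon$.
   Context: Setting: $I=[\xi,\eta]$ with $\xi<\eta$; $0<\varepsilon<1$ is a small parameter; $a:I\to\mathbb{R}$ satisfies $a(x)\ge a_0>0$. The initial values $\varphi_0,\varphi_1\in\mathbb{C}$ may depend on $\varepsilon$ but are bounded uniformly in $\varepsilon$. WKB functions: two sequences $(S_n^{\pm})_{n\in\mathbb{N}_0}$ are defined by $(S_0^{\pm})'=\pm \mathrm{i}\sqrt{a}$ and, writing $S_n$ for either $S_n^+$ or $S_n^-$, $$S_1'=-\frac{S_0''}{2S_0'},\qquad S_n'=-\frac{1}{2S_0'}\Big(\sum_{j=1}^{n-1}S_j'S_{n-j}'+S_{n-1}''\Big)\quad (n\ge 2),\qquad S_n^{\pm}(x):=\int_\xi^x (S_n^{\pm})'(\tau)\,\mathrm{d}\tau .$$ Hypothesis A: $S_0'$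 is (extends to) a holomorphic function on a bounded, simply connected complex neighbourhood $G\subset\mathbb{C}$ of $I$ (an open set containing $I$), with $S_0'(z)\ne 0$ for all $z\in G$. WKB approximation: for $N\in\mathbb{N}_0$, $$\varphi_N^{WKB}:=\alpha_{N,\varepsilon}\exp\Big(\sum_{n=0}^N\varepsilon^{n-1}S_n^-\Big)+\beta_{N,\varepsilon}\exp\Big(\sum_{n=0}^N\varepsilon^{n-1}S_n^+\Big),$$ $$\alpha_{N,\varepsilon}=\frac{\varphi_0\sum_{n=0}^N\varepsilon^n(S_n^+)'(\xi)-\varphi_1}{\sum_{n=0}^N\varepsilon^n\big((S_n^+)'(\xi)-(S_n^-)'(\xi)\big)},\qquad \beta_{N,\varepsilon}=\frac{\varphi_1-\varphi_0\sum_{n=0}^N\varepsilon^n(S_n^-)'(\xi)}{\sum_{n=0}^N\varepsilon^n\big((S_n^+)'(\xi)-(S_n^-)'(\xi)\big)},$$ so that $\varphi_N^{WKB}$ satisfies the initial conditions of the initial value problem. *)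

theory Defs
  imports
    "HOL-Complex_Analysis.Complex_Analysis"
    "HOL-Probability.Essential_Supremum"
begin

text \<open>
  All functions live on the real interval \<open>I = [\<xi>,\<eta>]\<close>: derivatives are taken within \<open>I\<close>
  (one-sided at the endpoints), so values outside \<open>I\<close> are irrelevant.

  \<open>dS \<xi> \<eta> a \<sigma> n\<close> is \<open>S\<^sub>n'\<close>, where \<open>\<sigma> = 1\<close> gives the \<open>+\<close> branch and \<open>\<sigma> = -1\<close> the \<open>-\<close> branch.
\<close>

fun dS :: "real \<Rightarrow> real \<Rightarrow> (real \<Rightarrow> real) \<Rightarrow> complex \<Rightarrow> nat \<Rightarrow> real \<Rightarrow> complex" where
  "dS \<xi> \<eta> a \<sigma> 0 = (\<lambda>x. \<sigma> * \<i> * complex_of_real (sqrt (a x)))"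
| "dS \<xi> \<eta> a \<sigma> (Suc 0) =
     (\<lambda>x. - vector_derivative (dS \<xi> \<eta> a \<sigma> 0) (at x within {\<xi>..\<eta>}) / (2 * dS \<xi> \<eta> a \<sigma> 0 x))"
| "dS \<xi> \<eta> a \<sigma> (Suc (Suc n)) =
     (\<lambda>x. - (1 / (2 * dS \<xi> \<eta> a \<sigma> 0 x)) *
        ((\<Sum>j=1..Suc n. dS \<xi> \<eta> a \<sigma> j x * dS \<xi> \<eta> a \<sigma> (Suc (Suc n) - j) x)
          + vector_derivative (dS \<xi> \<eta> a \<sigma> (Suc n)) (at x within {\<xi>..\<eta>})))"

definition S :: "real \<Rightarrow> real \<Rightarrow> (real \<Rightarrow> real) \<Rightarrow> complex \<Rightarrow> nat \<Rightarrow> real \<Rightarrow> complex" where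
  "S \<xi> \<eta> a \<sigma> n x = integral {\<xi>..x} (dS \<xi> \<eta> a \<sigma> n)"

text \<open>
  The extension is required for \<open>S\<^sub>0'\<close> of the \<open>+\<close> branch; its negative then serves the \<open>-\<close> branch.
\<close>

definition hypothesis_A :: "real \<Rightarrow> real \<Rightarrow> (real \<Rightarrow> real) \<Rightarrow> bool" where
  "hypothesis_A \<xi> \<eta> a \<longleftrightarrow>
     (\<exists>G F. open G \<and> bounded G \<and> simply_connected G \<and> complex_of_real ` {\<xi>..\<eta>} \<subseteq> G \<and>
        F holomorphic_on G \<and> (\<forall>x\<in>{\<xi>..\<eta>}. F (complex_of_real x) = dS \<xi> \<eta> a 1 0 x) \<and>
        (\<forall>z\<in>G. F z \<noteq> 0))"

definition \<alpha>_WKB ::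
    "real \<Rightarrow> real \<Rightarrow> (real \<Rightarrow> real) \<Rightarrow> complex \<Rightarrow> complex \<Rightarrow> nat \<Rightarrow> real \<Rightarrow> complex" where
  "\<alpha>_WKB \<xi> \<eta> a \<phi>0 \<phi>1 N \<epsilon> =
     (\<phi>0 * (\<Sum>n=0..N. complex_of_real (\<epsilon> ^ n) * dS \<xi> \<eta> a 1 n \<xi>) - \<phi>1) /
     (\<Sum>n=0..N. complex_of_real (\<epsilon> ^ n) * (dS \<xi> \<eta> a 1 n \<xi> - dS \<xi> \<eta> a (-1) n \<xi>))"

definition \<beta>_WKB ::
    "real \<Rightarrow> real \<Rightarrow> (real \<Rightarrow> real) \<Rightarrow> complex \<Rightarrow> complex \<Rightarrow> nat \<Rightarrow> real \<Rightarrow> complex" where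
  "\<beta>_WKB \<xi> \<eta> a \<phi>0 \<phi>1 N \<epsilon> =
     (\<phi>1 - \<phi>0 * (\<Sum>n=0..N. complex_of_real (\<epsilon> ^ n) * dS \<xi> \<eta> a (-1) n \<xi>)) /
     (\<Sum>n=0..N. complex_of_real (\<epsilon> ^ n) * (dS \<xi> \<eta> a 1 n \<xi> - dS \<xi> \<eta> a (-1) n \<xi>))"

definition \<phi>_WKB ::
    "real \<Rightarrow> real \<Rightarrow> (real \<Rightarrow> real) \<Rightarrow> complex \<Rightarrow> complex \<Rightarrow> nat \<Rightarrow> real \<Rightarrow> real \<Rightarrow> complex" where
  "\<phi>_WKB \<xi> \<eta> a \<phi>0 \<phi>1 N \<epsilon> x =
     \<alpha>_WKB \<xi> \<eta> a \<phi>0 \<phi>1 N \<epsilon> *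
       exp (\<Sum>n=0..N. complex_of_real (\<epsilon> powi (int n - 1)) * S \<xi> \<eta> a (-1) n x) +
     \<beta>_WKB \<xi> \<eta> a \<phi>0 \<phi>1 N \<epsilon> *
       exp (\<Sum>n=0..N. complex_of_real (\<epsilon> powi (int n - 1)) * S \<xi> \<eta> a 1 n x)"

definition ivp_solution ::
    "real \<Rightarrow> real \<Rightarrow> (real \<Rightarrow> real) \<Rightarrow> real \<Rightarrow> complex \<Rightarrow> complex \<Rightarrow> (real \<Rightarrow> complex) \<Rightarrow> bool" where
  "ivp_solution \<xi> \<eta> a \<epsilon> \<phi>0 \<phi>1 \<phi> \<longleftrightarrow>
     (\<exists>\<phi>' \<phi>''.
        (\<forall>x\<in>{\<xi>..\<eta>}. (\<phi> has_vector_derivative \<phi>' x) (at x within {\<xi>..\<eta>})) \<and>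
        (\<forall>x\<in>{\<xi>..\<eta>}. (\<phi>' has_vector_derivative \<phi>'' x) (at x within {\<xi>..\<eta>})) \<and>
        continuous_on {\<xi>..\<eta>} \<phi>'' \<and>
        (\<forall>x\<in>{\<xi>..\<eta>}. complex_of_real (\<epsilon>\<^sup>2) * \<phi>'' x + complex_of_real (a x) * \<phi> x = 0) \<and>
        \<phi> \<xi> = \<phi>0 \<and> complex_of_real \<epsilon> * \<phi>' \<xi> = \<phi>1)"

text \<open>
  Extended-real valued; \<^const>\<open>esssup\<close> is \<open>\<infinity>\<close> on non-measurable functions, so a finite bound
  entails measurability of \<open>\<lambda>x. cmod (f x)\<close>.
\<close>

definition Linf_norm :: "real set \<Rightarrow> (real \<Rightarrow> complex) \<Rightarrow> ereal" where
  "Linf_norm A f = esssup (lebesgue_on A) (\<lambda>x. ereal (cmod (f x)))"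

end

theory Submission imports Defs begin

text \<open>
  Each \<open>S\<^sub>n'\<close> extends holomorphically to \<open>G\<close>, where its recursion costs one derivative per step. Cauchy
  estimates on discs around a point of \<open>I\<close> whose radii shrink in \<open>N + 1\<close> equal steps give
  \<open>\<bar>S\<^sub>n'\<bar> \<le> B (\<kappa> (N + 1))\<^sup>n\<close> on \<open>I\<close> for all \<open>n \<le> N\<close>. With \<open>W = (\<Sum>n\<le>N. \<epsilon>\<^sup>n S\<^sub>n')\<close>, an exponential
  \<open>w\<close> with \<open>\<epsilon> w' = W w\<close> leaves the residual \<open>(W\<^sup>2 + \<epsilon> W' + a) w\<close> in the differential equation, and the
  recursion cancels all powers of \<open>\<epsilon>\<close> up to \<open>N\<close> in it. What remains is of size
  \<open>N\<^sup>2 (\<epsilon> \<kappa> (N + 1))\<^bsup>N + 1\<^esup>\<close>, which is exponentially small for \<open>N + 1 \<approx> 1 / (2 \<kappa> \<epsilon>)\<close>.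
  Since \<open>a\<close> is real and positive, an energy estimate turns a residual of size \<open>R\<close> into an error of size
  \<open>R / \<epsilon>\<close>.
\<close>

subsection \<open>Holomorphic WKB coefficients\<close>

lemma sum_inverse_squares_le:
  "(\<Sum>j=1..n. 1 / (real j)\<^sup>2) \<le> 2"
proof -
  \<comment> \<open>The sharper bound \<open>2 - 1 / n\<close> can be carried through the induction:
    the next summand is at most \<open>1 / n - 1 / (n + 1)\<close>, which telescopes.\<close>
  have "(\<Sum>j=1..Suc n. 1 / (real j)\<^sup>2) \<le> 2 - 1 / real (Suc n)" for n
  proof (induction n)
    case (Suc n)
    have "1 / (real (Suc (Suc n)))\<^sup>2 \<le> 1 / (real (Suc n) * real (Suc (Suc n)))"
      by (intro divide_left_mono) (auto simp: power2_eq_square)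
    also have "\<dots> = 1 / real (Suc n) - 1 / real (Suc (Suc n))"
      by (simp add: divide_simps)
    finally show ?case using Suc by simp
  qed auto
  from this[of "n - 1"] show ?thesis
    by (cases n) (auto intro: order_trans)
qed

text \<open>With \<open>u + v = n + 1\<close>, dividing \<open>(u + v)^2 \<le> 2 (u^2 + v^2)\<close>
  by the three squares separates the product \<open>1 / (u^2 v^2)\<close> into two sums of inverse
  squares. Each of these is at most 2, so the constant is \<open>2 * (2 + 2)\<close>.\<close>

lemma convolution_inverse_squares_le:
  "(\<Sum>j=1..n. 1 / ((real j)\<^sup>2 * (real (Suc n - j))\<^sup>2)) \<le> 8 / (real (Suc n))\<^sup>2"
proof -
  have "(\<Sum>j=1..n. 1 / ((real j)\<^sup>2 * (real (Suc n - j))\<^sup>2))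
      \<le> (\<Sum>j=1..n. 2 / (real (Suc n))\<^sup>2 * (1 / (real j)\<^sup>2 + 1 / (real (Suc n - j))\<^sup>2))"
  proof (rule sum_mono)
    fix j assume "j \<in> {1..n}"
    then obtain k where k: "Suc n = j + k" "k > 0" "j > 0"
      by (metis atLeastAtMost_iff le_SucI le_Suc_ex less_Suc_eq_le less_add_same_cancel1 less_le_trans zero_less_one)
    define u v where "u = real j" and "v = real k"
    have uv: "u > 0" "v > 0" "real (Suc n) = u + v" "real (Suc n - j) = v"
      using k by (auto simp: u_def v_def)
    have "(u + v)\<^sup>2 \<le> 2 * (u\<^sup>2 + v\<^sup>2)"
      using zero_le_power2[of "u - v"] by (simp add: power2_eq_square algebra_simps)
    then have "1 / (u\<^sup>2 * v\<^sup>2) \<le> 2 / (u + v)\<^sup>2 * (1 / u\<^sup>2 + 1 / v\<^sup>2)"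
      using uv(1,2) by (simp add: divide_simps add.commute)
    then show "1 / ((real j)\<^sup>2 * (real (Suc n - j))\<^sup>2)
        \<le> 2 / (real (Suc n))\<^sup>2 * (1 / (real j)\<^sup>2 + 1 / (real (Suc n - j))\<^sup>2)"
      unfolding uv(3,4) u_def[symmetric] .
  qed
  also have "\<dots> = 2 / (real (Suc n))\<^sup>2 *
      ((\<Sum>j=1..n. 1 / (real j)\<^sup>2) + (\<Sum>j=1..n. 1 / (real (Suc n - j))\<^sup>2))"
    by (simp only: sum_distrib_left[symmetric] sum.distrib)
  also have "(\<Sum>j=1..n. 1 / (real (Suc n - j))\<^sup>2) = (\<Sum>j=1..n. 1 / (real j)\<^sup>2)"
    by (rule sum.reindex_bij_witness[of _ "\<lambda>j. Suc n - j" "\<lambda>j. Suc n - j"]) auto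
  also have "2 / (real (Suc n))\<^sup>2 * ((\<Sum>j=1..n. 1 / (real j)\<^sup>2) + (\<Sum>j=1..n. 1 / (real j)\<^sup>2))
      \<le> 2 / (real (Suc n))\<^sup>2 * (2 + 2)"
    by (intro mult_left_mono add_mono sum_inverse_squares_le) auto
  finally show ?thesis by simp
qed

text \<open>The sum is empty for \<open>n = 0\<close>, so one successor clause covers both the first
  coefficient and the higher ones. The sign of the branch is contained in \<open>f\<close>.\<close>

fun wkb_coeff :: "(complex \<Rightarrow> complex) \<Rightarrow> nat \<Rightarrow> complex \<Rightarrow> complex" where
  "wkb_coeff f 0 = f"
| "wkb_coeff f (Suc n) = (\<lambda>z. - (1 / (2 * f z)) *
     ((\<Sum>j=1..n. wkb_coeff f j z * wkb_coeff f (Suc n - j) z) + deriv (wkb_coeff f n) z))"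

lemma holomorphic_wkb_coeff:
  assumes "open G" "f holomorphic_on G" "\<And>z. z \<in> G \<Longrightarrow> f z \<noteq> 0"
  shows "wkb_coeff f n holomorphic_on G"
proof (induction n rule: less_induct)
  case (less n)
  show ?case
  proof (cases n)
    case 0
    then show ?thesis using assms by simp
  next
    case (Suc k)
    have "(\<lambda>z. (\<Sum>j=1..k. wkb_coeff f j z * wkb_coeff f (Suc k - j) z)) holomorphic_on G"
      using Suc by (intro holomorphic_intros less) auto
    moreover have "deriv (wkb_coeff f k) holomorphic_on G"
      using Suc assms(1) by (intro holomorphic_deriv less) auto
    ultimately show ?thesis
      unfolding Suc wkb_coeff.simps using assms
      by (intro holomorphic_on_mult holomorphic_on_minus holomorphic_on_divide holomorphic_on_add
          holomorphic_on_const) auto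
  qed
qed

lemma norm_deriv_le_Cauchy:
  assumes "f holomorphic_on G" "open G" "cball z \<rho> \<subseteq> G" "\<rho> > 0"
    and "\<And>w. w \<in> cball z \<rho> \<Longrightarrow> norm (f w) \<le> B"
  shows "norm (deriv f z) \<le> B / \<rho>"
proof -
  have "f holomorphic_on ball z \<rho>" "continuous_on (cball z \<rho>) f"
    using assms(1,3) ball_subset_cball[of z \<rho>]
    by (meson holomorphic_on_imp_continuous_on holomorphic_on_subset subset_trans)+
  then have "norm ((deriv ^^ 1) f z) \<le> fact 1 * B / \<rho> ^ 1"
    using assms by (intro Cauchy_inequality) (auto simp: dist_norm)
  then show ?thesis by simp
qed

text \<open>The weight \<open>1 / n\<^sup>2\<close> is reproduced, up to the factor \<open>8\<close>, by the convolution in the recursion;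
  the factor \<open>m / 8\<close> absorbs that \<open>8\<close>.\<close>

lemma norm_wkb_coeff_le:
  fixes B m \<rho> \<delta> :: real and c :: complex
  assumes G: "open G" "f holomorphic_on G" "\<And>z. z \<in> G \<Longrightarrow> f z \<noteq> 0"
    and sub: "cball c \<delta> \<subseteq> G" and "\<rho> > 0" "m > 0" "K \<ge> 4 * B / m\<^sup>2"
    and f: "\<And>z. z \<in> cball c \<delta> \<Longrightarrow> m \<le> norm (f z) \<and> norm (f z) \<le> B"
    and "n \<ge> 1" "z \<in> cball c (\<delta> - real n * \<rho>)"
  shows "norm (wkb_coeff f n z) \<le> m / 8 * (K / \<rho>) ^ n / (real n)\<^sup>2"
  using assms(9-)
proof (induction n arbitrary: z rule: less_induct)
  case (less n z)
  then obtain k where n: "n = Suc k" by (cases n) auto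
  have z\<delta>: "z \<in> cball c \<delta>"
  proof -
    have "real n * \<rho> \<ge> 0" using \<open>\<rho> > 0\<close> by simp
    moreover have "dist c z \<le> \<delta> - real n * \<rho>" using less.prems by simp
    ultimately show ?thesis unfolding mem_cball by linarith
  qed
  have mB: "m \<le> B" using f[OF z\<delta>] by linarith
  \<comment> \<open>The lower bound on \<open>K\<close> serves twice: as it stands for the first
    coefficient, where \<open>deriv f\<close> is at most \<open>B / \<rho>\<close>, and in the
    weaker form \<open>K \<ge> 4 / m\<close> for all later ones.\<close>
  have "4 / m \<le> 4 * B / m\<^sup>2"
    using mB \<open>m > 0\<close> by (simp add: field_simps power2_eq_square)
  with assms have K: "K \<ge> 4 / m" "K > 0"
    using \<open>m > 0\<close> by (auto intro: order_trans less_le_trans[of 0 "4 / m"])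
  define q where "q = K / \<rho>"
  have q: "q > 0" using K \<open>\<rho> > 0\<close> by (simp add: q_def)
  \<comment> \<open>One Cauchy radius is spent per derivative: the disc of radius
    \<open>\<rho>\<close> about \<open>z\<close> lies in the larger disc on which coefficient
    \<open>k = n - 1\<close> is controlled. This is why \<open>z\<close> varies in the
    induction.\<close>
  have near: "w \<in> cball c (\<delta> - real k * \<rho>)" if "w \<in> cball z \<rho>" for w
    using that less.prems dist_triangle[of c w z] unfolding n by (auto simp: algebra_simps)
  have cb: "cball z \<rho> \<subseteq> cball c \<delta>"
  proof
    fix w assume "w \<in> cball z \<rho>"
    from near[OF this] have "dist c w \<le> \<delta> - real k * \<rho>" by simp
    moreover have "real k * \<rho> \<ge> 0" using \<open>\<rho> > 0\<close> by simp
    ultimately show "w \<in> cball c \<delta>" unfolding mem_cball by linarith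
  qed
  have hol: "wkb_coeff f k holomorphic_on G"
    using G by (rule holomorphic_wkb_coeff)
  have lower: "norm (1 / (2 * f z)) \<le> 1 / (2 * m)"
    using f[OF z\<delta>] \<open>m > 0\<close> by (auto simp: norm_divide norm_mult intro!: divide_left_mono mult_pos_pos)
  show ?case
  proof (cases "k = 0")
    case True
    have "norm (deriv f z) \<le> B / \<rho>"
      using cb sub f by (intro norm_deriv_le_Cauchy[OF G(2,1)] \<open>\<rho> > 0\<close>) auto
    then have "norm (1 / (2 * f z)) * norm (deriv f z) \<le> 1 / (2 * m) * (B / \<rho>)"
      using lower \<open>m > 0\<close> by (intro mult_mono) auto
    also have "\<dots> = m / 8 * (4 * B / m\<^sup>2 / \<rho>)"
      using \<open>m > 0\<close> by (simp add: power2_eq_square)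
    also have "\<dots> \<le> m / 8 * (K / \<rho>)"
      using assms by (intro mult_left_mono divide_right_mono) auto
    finally show ?thesis by (simp add: n True norm_mult norm_divide)
  next
    case False
    have IH: "norm (wkb_coeff f j z) \<le> m / 8 * q ^ j / (real j)\<^sup>2" if "1 \<le> j" "j \<le> k" for j
    proof -
      have "z \<in> cball c (\<delta> - real j * \<rho>)"
      proof -
        have "real j * \<rho> \<le> real n * \<rho>" using that \<open>\<rho> > 0\<close> n by (intro mult_right_mono) auto
        then show ?thesis using less.prems by auto
      qed
      then show ?thesis using less.IH[of j z] that n by (simp add: q_def)
    qed
    have "norm (\<Sum>j=1..k. wkb_coeff f j z * wkb_coeff f (Suc k - j) z)
        \<le> (\<Sum>j=1..k. (m / 8)\<^sup>2 * q ^ n * (1 / ((real j)\<^sup>2 * (real (Suc k - j))\<^sup>2)))"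
    proof (rule sum_norm_le)
      fix j assume j: "j \<in> {1..k}"
      have "norm (wkb_coeff f j z * wkb_coeff f (Suc k - j) z)
          \<le> (m / 8 * q ^ j / (real j)\<^sup>2) * (m / 8 * q ^ (Suc k - j) / (real (Suc k - j))\<^sup>2)"
        unfolding norm_mult using j q \<open>m > 0\<close> by (intro mult_mono IH) auto
      also have "\<dots> = (m / 8)\<^sup>2 * (q ^ j * q ^ (Suc k - j)) * (1 / ((real j)\<^sup>2 * (real (Suc k - j))\<^sup>2))"
        by (simp add: power2_eq_square mult_ac)
      also have "q ^ j * q ^ (Suc k - j) = q ^ n"
        using j n by (simp flip: power_add)
      finally show "norm (wkb_coeff f j z * wkb_coeff f (Suc k - j) z)
        \<le> (m / 8)\<^sup>2 * q ^ n * (1 / ((real j)\<^sup>2 * (real (Suc k - j))\<^sup>2))" .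
    qed
    also have "\<dots> = (m / 8)\<^sup>2 * q ^ n * (\<Sum>j=1..k. 1 / ((real j)\<^sup>2 * (real (Suc k - j))\<^sup>2))"
      by (simp add: sum_distrib_left)
    also have "\<dots> \<le> (m / 8)\<^sup>2 * q ^ n * (8 / (real n)\<^sup>2)"
      unfolding n using q by (intro mult_left_mono convolution_inverse_squares_le) auto
    finally have conv: "norm (\<Sum>j=1..k. wkb_coeff f j z * wkb_coeff f (Suc k - j) z)
        \<le> (m / 8)\<^sup>2 * q ^ n * (8 / (real n)\<^sup>2)" .
    have "norm (deriv (wkb_coeff f k) z) \<le> (m / 8 * q ^ k / (real k)\<^sup>2) / \<rho>"
      using less.IH[of k] n False near cb sub
      by (intro norm_deriv_le_Cauchy[OF hol G(1)] \<open>\<rho> > 0\<close>) (auto simp: q_def)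
    also have "\<dots> = m / 8 * (q ^ k / \<rho>) * (1 / (real k)\<^sup>2)"
      by simp
    also have "\<dots> \<le> m / 8 * (q ^ k / \<rho>) * (4 / (real n)\<^sup>2)"
    proof (rule mult_left_mono)
      have "real n \<le> 2 * real k" using False n by auto
      then have "(real n)\<^sup>2 \<le> (2 * real k)\<^sup>2" by (intro power_mono) auto
      then show "1 / (real k)\<^sup>2 \<le> 4 / (real n)\<^sup>2"
        using False n by (simp add: divide_simps power_mult_distrib)
    qed (use q \<open>m > 0\<close> \<open>\<rho> > 0\<close> in auto)
    also have "\<dots> = m / 8 * (4 / \<rho> * q ^ k) / (real n)\<^sup>2"
      by simp
    also have "\<dots> \<le> m / 8 * (m * q * q ^ k) / (real n)\<^sup>2"
    proof -
      have "4 / \<rho> \<le> m * q"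
        using K(1) \<open>m > 0\<close> \<open>\<rho> > 0\<close> by (simp add: q_def field_simps)
      then show ?thesis
        using q \<open>m > 0\<close> by (intro divide_right_mono mult_left_mono mult_right_mono) auto
    qed
    finally have der: "norm (deriv (wkb_coeff f k) z) \<le> m / 8 * (m * q ^ n) / (real n)\<^sup>2"
      by (simp add: n mult.assoc)
    \<comment> \<open>The constants close up exactly: apart from the common factor
      \<open>q ^ n / n^2\<close>, the convolution and the derivative contribute
      \<open>m^2 / 8\<close> each, and their sum divided by \<open>2 m\<close> is
      \<open>m / 8\<close> again.\<close>
    have "norm (wkb_coeff f n z) = norm (1 / (2 * f z)) *
       norm ((\<Sum>j=1..k. wkb_coeff f j z * wkb_coeff f (Suc k - j) z) + deriv (wkb_coeff f k) z)"
      unfolding n wkb_coeff.simps norm_mult norm_minus_cancel ..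
    also have "\<dots> \<le> 1 / (2 * m) *
       ((m / 8)\<^sup>2 * q ^ n * (8 / (real n)\<^sup>2) + m / 8 * (m * q ^ n) / (real n)\<^sup>2)"
      using \<open>m > 0\<close> by (intro mult_mono lower order_trans[OF norm_triangle_ineq] add_mono conv der) auto
    also have "\<dots> = m / 8 * q ^ n / (real n)\<^sup>2"
      using \<open>m > 0\<close> by (simp add: power2_eq_square divide_simps)
    finally show ?thesis by (simp add: q_def)
  qed
qed

subsection \<open>Energy estimate and Riccati residual\<close>

text \<open>In the derivative of the energy \<open>E\<close>, the terms with \<open>\<psi>''\<close>
  and \<open>a\<close> combine into twice the inner product of \<open>\<psi>'\<close> with the
  residual. No negative power of \<open>\<epsilon>\<close> then enters the growth rate, and
  Gronwall's argument bounds \<open>E\<close> by a multiple of \<open>(R / \<epsilon>)^2\<close>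
  whose factor is independent of \<open>\<epsilon>\<close>. The lower bound on \<open>a\<close>
  recovers \<open>\<psi>\<close> from \<open>E\<close>.\<close>

lemma oscillator_energy_estimate:
  fixes \<psi> \<psi>' \<psi>'' :: "real \<Rightarrow> complex" and a a' :: "real \<Rightarrow> real"
  assumes "\<epsilon> > 0" "a0 > 0" "R \<ge> 0"
    and d1: "\<And>x. x \<in> {\<xi>..\<eta>} \<Longrightarrow> (\<psi> has_vector_derivative \<psi>' x) (at x within {\<xi>..\<eta>})"
    and d2: "\<And>x. x \<in> {\<xi>..\<eta>} \<Longrightarrow> (\<psi>' has_vector_derivative \<psi>'' x) (at x within {\<xi>..\<eta>})"
    and da: "\<And>x. x \<in> {\<xi>..\<eta>} \<Longrightarrow> (a has_real_derivative a' x) (at x within {\<xi>..\<eta>})"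
    and a: "\<And>x. x \<in> {\<xi>..\<eta>} \<Longrightarrow> a x \<ge> a0" and a': "\<And>x. x \<in> {\<xi>..\<eta>} \<Longrightarrow> \<bar>a' x\<bar> \<le> A"
    and R: "\<And>x. x \<in> {\<xi>..\<eta>} \<Longrightarrow>
      norm (complex_of_real (\<epsilon>\<^sup>2) * \<psi>'' x + complex_of_real (a x) * \<psi> x) \<le> R"
    and "\<psi> \<xi> = 0" "\<psi>' \<xi> = 0" and x: "x \<in> {\<xi>..\<eta>}"
  shows "norm (\<psi> x) \<le> sqrt ((\<eta> - \<xi>) * exp ((1 + A / a0) * (\<eta> - \<xi>)) / a0) * (R / \<epsilon>)"
proof -
  \<comment> \<open>\<open>K\<close> dominates the growth rates of both parts of the energy: 1
    arises for the part with \<open>\<psi>'\<close> when the product with the residual is split, and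
    \<open>A / a0\<close> for the other part from \<open>a' \<le> (A / a0) a\<close>.\<close>
  define K where "K = 1 + A / a0"
  have "A \<ge> 0" using a'[OF x] by linarith
  then have K: "K \<ge> 1" using \<open>a0 > 0\<close> by (simp add: K_def)
  define E where "E x = \<epsilon>\<^sup>2 * (\<psi>' x \<bullet> \<psi>' x) + a x * (\<psi> x \<bullet> \<psi> x)" for x
  define E' where "E' x = 2 * \<epsilon>\<^sup>2 * (\<psi>' x \<bullet> \<psi>'' x) + a' x * (\<psi> x \<bullet> \<psi> x) + 2 * a x * (\<psi> x \<bullet> \<psi>' x)" for x
  have dE: "(E has_real_derivative E' t) (at t within {\<xi>..\<eta>})" if t: "t \<in> {\<xi>..\<eta>}" for t
  proof -
    have inner: "((\<lambda>x. f x \<bullet> f x) has_real_derivative 2 * (f t \<bullet> f')) (at t within {\<xi>..\<eta>})"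
      if "(f has_vector_derivative f') (at t within {\<xi>..\<eta>})" for f :: "real \<Rightarrow> complex" and f'
      using that unfolding has_vector_derivative_def has_field_derivative_def
      by (auto intro!: derivative_eq_intros simp: fun_eq_iff inner_commute)
    show ?thesis
      unfolding E_def E'_def
      by (rule derivative_eq_intros inner[OF d1[OF t]] inner[OF d2[OF t]] da[OF t] refl)+ (simp add: algebra_simps)
  qed
  have E0: "E t \<ge> 0" if "t \<in> {\<xi>..\<eta>}" for t
    using a[OF that] \<open>a0 > 0\<close> by (simp add: E_def)
  have E': "E' t \<le> R\<^sup>2 / \<epsilon>\<^sup>2 + K * E t" if t: "t \<in> {\<xi>..\<eta>}" for t
  proof -
    define g where "g = complex_of_real (\<epsilon>\<^sup>2) * \<psi>'' t + complex_of_real (a t) * \<psi> t"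
    have g: "g = \<epsilon>\<^sup>2 *\<^sub>R \<psi>'' t + a t *\<^sub>R \<psi> t" by (simp add: g_def scaleR_conv_of_real)
    have "E' t = 2 * (\<psi>' t \<bullet> g) + a' t * (\<psi> t \<bullet> \<psi> t)"
      by (simp add: E'_def g inner_add_right inner_commute algebra_simps)
    also have "2 * (\<psi>' t \<bullet> g) \<le> R\<^sup>2 / \<epsilon>\<^sup>2 + \<epsilon>\<^sup>2 * (\<psi>' t \<bullet> \<psi>' t)"
    proof -
      have "\<psi>' t \<bullet> g \<le> norm (\<psi>' t) * R"
        using norm_cauchy_schwarz[of "\<psi>' t" g] mult_left_mono[OF R[OF t], of "norm (\<psi>' t)"]
        by (simp add: g_def)
      moreover have "0 \<le> (R / \<epsilon> - \<epsilon> * norm (\<psi>' t))\<^sup>2" by simp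
      then have "2 * (norm (\<psi>' t) * R) \<le> R\<^sup>2 / \<epsilon>\<^sup>2 + \<epsilon>\<^sup>2 * (norm (\<psi>' t))\<^sup>2"
        using \<open>\<epsilon> > 0\<close> by (simp add: power2_diff power_divide power_mult_distrib algebra_simps)
      ultimately show ?thesis by (simp add: power2_norm_eq_inner)
    qed
    also have "a' t * (\<psi> t \<bullet> \<psi> t) \<le> (A / a0) * (a t * (\<psi> t \<bullet> \<psi> t))"
    proof -
      have "a' t \<le> A / a0 * a0" using a'[OF t] \<open>a0 > 0\<close> by simp
      also have "\<dots> \<le> A / a0 * a t" using \<open>A \<ge> 0\<close> \<open>a0 > 0\<close> a[OF t] by (intro mult_left_mono) auto
      finally show ?thesis
        by (metis inner_ge_zero mult.assoc mult_right_mono)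
    qed
    also have "A / a0 * (a t * (\<psi> t \<bullet> \<psi> t)) \<le> K * (a t * (\<psi> t \<bullet> \<psi> t))"
      using a[OF t] \<open>a0 > 0\<close> by (intro mult_right_mono) (auto simp: K_def)
    also have "\<epsilon>\<^sup>2 * (\<psi>' t \<bullet> \<psi>' t) \<le> K * (\<epsilon>\<^sup>2 * (\<psi>' t \<bullet> \<psi>' t))"
      using K mult_right_mono[of 1 K "\<epsilon>\<^sup>2 * (\<psi>' t \<bullet> \<psi>' t)"] by simp
    finally show ?thesis by (simp add: E_def algebra_simps)
  qed
  \<comment> \<open>Gronwall's argument: after multiplication by the integrating factor, which is at
    most 1, the energy grows no faster than the subtracted linear function, so \<open>h\<close> is
    nonincreasing.\<close>
  define h where "h t = exp (- K * (t - \<xi>)) * E t - R\<^sup>2 / \<epsilon>\<^sup>2 * (t - \<xi>)" for t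
  have dh: "(h has_real_derivative exp (- K * (t - \<xi>)) * (E' t - K * E t) - R\<^sup>2 / \<epsilon>\<^sup>2)
      (at t within {\<xi>..\<eta>})" if t: "t \<in> {\<xi>..\<eta>}" for t
    unfolding h_def
    by (rule derivative_eq_intros dE[OF t] refl)+ (simp add: algebra_simps)
  have "h x \<le> h \<xi>"
  proof (rule DERIV_nonpos_imp_decreasing_open[where f = h])
    show "continuous_on {\<xi>..x} h"
      by (rule continuous_on_subset[OF DERIV_continuous_on[OF dh]]) (use x in auto)
    fix t assume t: "\<xi> < t" "t < x"
    then have tI: "t \<in> {\<xi>..\<eta>}" using x by auto
    have "exp (- K * (t - \<xi>)) * (E' t - K * E t) \<le> exp (- K * (t - \<xi>)) * (R\<^sup>2 / \<epsilon>\<^sup>2)"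
      using E'[OF tI] by (intro mult_left_mono) auto
    also have "\<dots> \<le> 1 * (R\<^sup>2 / \<epsilon>\<^sup>2)"
      using K t by (intro mult_right_mono) auto
    finally show "\<exists>y. (h has_real_derivative y) (at t) \<and> y \<le> 0"
      using dh[OF tI] t x by (auto simp: at_within_Icc_at)
  qed (use x in auto)
  moreover have "h \<xi> = 0" using assms by (simp add: h_def E_def)
  ultimately have "exp (- K * (x - \<xi>)) * E x \<le> R\<^sup>2 / \<epsilon>\<^sup>2 * (x - \<xi>)"
    by (simp add: h_def)
  then have "exp (K * (x - \<xi>)) * (exp (- K * (x - \<xi>)) * E x) \<le> exp (K * (x - \<xi>)) * (R\<^sup>2 / \<epsilon>\<^sup>2 * (x - \<xi>))"
    by (intro mult_left_mono) auto
  also have "exp (K * (x - \<xi>)) * (exp (- K * (x - \<xi>)) * E x) = E x"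
    by (simp add: mult.assoc[symmetric] flip: exp_add)
  also have "exp (K * (x - \<xi>)) * (R\<^sup>2 / \<epsilon>\<^sup>2 * (x - \<xi>)) \<le> exp (K * (\<eta> - \<xi>)) * (R\<^sup>2 / \<epsilon>\<^sup>2 * (\<eta> - \<xi>))"
    using x K by (intro mult_mono) auto
  finally have "E x \<le> exp (K * (\<eta> - \<xi>)) * (R\<^sup>2 / \<epsilon>\<^sup>2 * (\<eta> - \<xi>))" .
  moreover have "a0 * (norm (\<psi> x))\<^sup>2 \<le> E x"
    unfolding E_def power2_norm_eq_inner using a[OF x]
    by (intro add_increasing mult_right_mono) auto
  ultimately have "(norm (\<psi> x))\<^sup>2 \<le> exp (K * (\<eta> - \<xi>)) * (R\<^sup>2 / \<epsilon>\<^sup>2 * (\<eta> - \<xi>)) / a0"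
    unfolding pos_le_divide_eq[OF \<open>a0 > 0\<close>] by (simp only: mult.commute[of _ a0])
  also have "\<dots> = (\<eta> - \<xi>) * exp (K * (\<eta> - \<xi>)) / a0 * (R / \<epsilon>)\<^sup>2"
    by (simp add: power_divide mult_ac)
  finally have "norm (\<psi> x) \<le> sqrt ((\<eta> - \<xi>) * exp (K * (\<eta> - \<xi>)) / a0 * (R / \<epsilon>)\<^sup>2)"
    by (rule real_le_rsqrt)
  then show ?thesis
    using \<open>R \<ge> 0\<close> \<open>\<epsilon> > 0\<close> unfolding real_sqrt_mult by (simp add: K_def)
qed

text \<open>In the application \<open>q n\<close> is \<open>\<epsilon>^n\<close> times coefficient
  \<open>n\<close> and \<open>q' n\<close> is \<open>\<epsilon>^n\<close> times its derivative.
  Products with \<open>i + j \<le> N\<close> cancel order by order: order 0 against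
  \<open>A\<close>, order \<open>k + 1\<close> against \<open>e * q' k\<close>. What survives is
  \<open>e * q' N\<close> and at most \<open>(N + 1)^2\<close> products with
  \<open>i + j > N\<close>, each no larger than \<open>B^2 * x ^ (N + 1)\<close> because
  \<open>x \<le> 1\<close>.\<close>

lemma riccati_residual_le:
  fixes q q' :: "nat \<Rightarrow> complex"
  assumes q0: "(q 0)\<^sup>2 = - A"
    and rec: "\<And>k. k < N \<Longrightarrow> (\<Sum>i\<le>Suc k. q i * q (Suc k - i)) = - (e * q' k)"
    and q: "\<And>n. n \<le> N \<Longrightarrow> norm (q n) \<le> B * x ^ n"
    and q': "norm (e * q' N) \<le> B * x ^ Suc N"
    and "0 \<le> x" "x \<le> 1"
  shows "norm ((\<Sum>n\<le>N. q n)\<^sup>2 + e * (\<Sum>n\<le>N. q' n) + A) \<le> (B + (real (Suc N) * B)\<^sup>2) * x ^ Suc N"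
proof -
  have "B \<ge> 0" using order_trans[OF norm_ge_zero q[of 0]] by simp
  define T where "T = {(i, j). i + j \<le> N}"
  have T: "T \<subseteq> {..N} \<times> {..N}" by (auto simp: T_def)
  have "(\<Sum>n\<le>N. q n)\<^sup>2 = (\<Sum>(i, j)\<in>{..N} \<times> {..N}. q i * q j)"
    by (simp add: power2_eq_square sum_product sum.cartesian_product)
  also have "\<dots> = (\<Sum>(i, j)\<in>{..N} \<times> {..N} - T. q i * q j) + (\<Sum>(i, j)\<in>T. q i * q j)"
    using T by (intro sum.subset_diff) auto
  also have "(\<Sum>(i, j)\<in>T. q i * q j) = (\<Sum>k\<le>N. \<Sum>i\<le>k. q i * q (k - i))"
    unfolding T_def by (rule sum.triangle_reindex_eq)
  also have "\<dots> = (q 0)\<^sup>2 + (\<Sum>k<N. \<Sum>i\<le>Suc k. q i * q (Suc k - i))"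
    by (simp add: sum.atMost_shift power2_eq_square del: sum.atMost_Suc)
  also have "(\<Sum>k<N. \<Sum>i\<le>Suc k. q i * q (Suc k - i)) = - (e * (\<Sum>k<N. q' k))"
    using rec by (simp add: sum_distrib_left sum_negf)
  finally have eq: "(\<Sum>n\<le>N. q n)\<^sup>2 + e * (\<Sum>n\<le>N. q' n) + A
      = e * q' N + (\<Sum>(i, j)\<in>{..N} \<times> {..N} - T. q i * q j)"
    using q0 by (simp add: lessThan_Suc_atMost[symmetric] algebra_simps)
  have "norm (\<Sum>(i, j)\<in>{..N} \<times> {..N} - T. q i * q j)
      \<le> (\<Sum>p\<in>{..N} \<times> {..N} - T. B\<^sup>2 * x ^ Suc N)"
  proof (rule sum_norm_le)
    fix p assume "p \<in> {..N} \<times> {..N} - T"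
    then obtain i j where p: "p = (i, j)" and ij: "i \<in> {..N}" "j \<in> {..N}" "(i, j) \<notin> T"
      by blast
    have "norm (q i * q j) \<le> (B * x ^ i) * (B * x ^ j)"
      unfolding norm_mult using ij \<open>B \<ge> 0\<close> \<open>0 \<le> x\<close> by (intro mult_mono q) auto
    also have "\<dots> = B\<^sup>2 * x ^ (i + j)" by (simp add: power2_eq_square power_add)
    also have "\<dots> \<le> B\<^sup>2 * x ^ Suc N"
      using ij \<open>0 \<le> x\<close> \<open>x \<le> 1\<close> by (intro mult_left_mono power_decreasing) (auto simp: T_def)
    finally show "norm (case p of (i, j) \<Rightarrow> q i * q j) \<le> B\<^sup>2 * x ^ Suc N"
      by (simp add: p)
  qed
  also have "\<dots> \<le> (\<Sum>p\<in>{..N} \<times> {..N}. B\<^sup>2 * x ^ Suc N)"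
    using \<open>0 \<le> x\<close> by (intro sum_mono2) auto
  also have "\<dots> = (real (Suc N) * B)\<^sup>2 * x ^ Suc N"
    by (simp add: power2_eq_square algebra_simps)
  finally have "norm (\<Sum>(i, j)\<in>{..N} \<times> {..N} - T. q i * q j) \<le> (real (Suc N) * B)\<^sup>2 * x ^ Suc N" .
  then show ?thesis
    unfolding eq using q' norm_triangle_ineq[of "e * q' N" "\<Sum>(i, j)\<in>{..N} \<times> {..N} - T. q i * q j"]
    by (simp add: distrib_right)
qed

lemma sum_linear_times_half_powers_le: "(\<Sum>n<N. real (n + 2) / 2 ^ n) \<le> 6"
proof -
  \<comment> \<open>The exact tail makes the induction go through; 6 is the value of the infinite
    series.\<close>
  have "(\<Sum>n<N. real (n + 2) / 2 ^ n) = 6 - real (2 * N + 6) / 2 ^ N"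
  proof (induction N)
    case (Suc N)
    have "6 - real (2 * N + 6) / 2 ^ N + real (N + 2) / 2 ^ N = 6 - real (2 * Suc N + 6) / 2 ^ Suc N"
      by (simp add: divide_simps)
    with Suc show ?case by simp
  qed simp
  then show ?thesis by simp
qed

subsection \<open>Coefficient bounds on the interval\<close>

text \<open>The terms \<open>i = 0\<close> and \<open>i = n + 1\<close> are both \<open>f\<close>
  times the newest coefficient, which accounts for the division by \<open>2 f\<close> in the
  recursion. In this form the recursion says that the power \<open>n + 1\<close> of
  \<open>\<epsilon>\<close> vanishes in the Riccati equation.\<close>

lemma wkb_coeff_convolution:
  assumes "f z \<noteq> 0"
  shows "(\<Sum>i\<le>Suc n. wkb_coeff f i z * wkb_coeff f (Suc n - i) z) = - deriv (wkb_coeff f n) z"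
proof -
  have "(\<Sum>i\<le>Suc n. wkb_coeff f i z * wkb_coeff f (Suc n - i) z)
      = 2 * f z * wkb_coeff f (Suc n) z + (\<Sum>j=1..n. wkb_coeff f j z * wkb_coeff f (Suc n - j) z)"
  proof -
    have "{..Suc n} = insert 0 (insert (Suc n) {1..n})" by auto
    then show ?thesis by (simp del: wkb_coeff.simps(2) atMost_Suc sum.atMost_Suc)
  qed
  also have "2 * f z * wkb_coeff f (Suc n) z
      = - ((\<Sum>j=1..n. wkb_coeff f j z * wkb_coeff f (Suc n - j) z) + deriv (wkb_coeff f n) z)"
    using assms by (simp add: divide_simps)
  finally show ?thesis by simp
qed

text \<open>On the interval, the one-sided or two-sided real derivative of a holomorphic function is
  its complex derivative. Hence agreement of coefficient \<open>k\<close> on the whole interval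
  passes to its derivative, and strong induction yields the next coefficient.\<close>

lemma dS_eq_wkb_coeff:
  assumes "\<xi> < \<eta>" "open G" "of_real ` {\<xi>..\<eta>} \<subseteq> G" "f holomorphic_on G"
    and "\<And>z. z \<in> G \<Longrightarrow> f z \<noteq> 0"
    and f: "\<And>x. x \<in> {\<xi>..\<eta>} \<Longrightarrow> f (of_real x) = dS \<xi> \<eta> a \<sigma> 0 x"
    and x: "x \<in> {\<xi>..\<eta>}"
  shows "dS \<xi> \<eta> a \<sigma> n x = wkb_coeff f n (of_real x)"
    and "(dS \<xi> \<eta> a \<sigma> n has_vector_derivative deriv (wkb_coeff f n) (of_real x)) (at x within {\<xi>..\<eta>})"
proof -
  have der: "(dS \<xi> \<eta> a \<sigma> k has_vector_derivative deriv (wkb_coeff f k) (of_real x)) (at x within {\<xi>..\<eta>})"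
    if eq: "\<And>x. x \<in> {\<xi>..\<eta>} \<Longrightarrow> dS \<xi> \<eta> a \<sigma> k x = wkb_coeff f k (of_real x)" and x: "x \<in> {\<xi>..\<eta>}" for k x
  proof (rule has_vector_derivative_transform[OF x])
    have "wkb_coeff f k holomorphic_on G"
      using assms by (intro holomorphic_wkb_coeff) auto
    then show "((\<lambda>x. wkb_coeff f k (of_real x)) has_vector_derivative
        deriv (wkb_coeff f k) (of_real x)) (at x within {\<xi>..\<eta>})"
      using assms(2,3) x
      by (intro has_vector_derivative_real_field holomorphic_derivI[of _ G]) auto
  qed (use eq in auto)
  have eq: "x \<in> {\<xi>..\<eta>} \<Longrightarrow> dS \<xi> \<eta> a \<sigma> n x = wkb_coeff f n (of_real x)" for n x
  proof (induction n arbitrary: x rule: less_induct)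
    case (less n x)
    show ?case
    proof (cases n)
      case 0
      then show ?thesis using f[OF less.prems] by simp
    next
      case (Suc k)
      have "vector_derivative (dS \<xi> \<eta> a \<sigma> k) (at x within {\<xi>..\<eta>}) = deriv (wkb_coeff f k) (of_real x)"
        using less Suc \<open>\<xi> < \<eta>\<close>
        by (intro vector_derivative_within_cbox[of \<xi> \<eta> x, simplified] der) auto
      moreover have "(\<Sum>j=1..k. dS \<xi> \<eta> a \<sigma> j x * dS \<xi> \<eta> a \<sigma> (Suc k - j) x)
          = (\<Sum>j=1..k. wkb_coeff f j (of_real x) * wkb_coeff f (Suc k - j) (of_real x))"
        using less Suc by (intro sum.cong) auto
      ultimately show ?thesis
        \<comment> \<open>The case split is needed because \<open>dS\<close> has separate clauses
          for the indices 1 and at least 2.\<close>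
        unfolding Suc using f[OF less.prems] by (cases k) auto
    qed
  qed
  show "dS \<xi> \<eta> a \<sigma> n x = wkb_coeff f n (of_real x)" by (rule eq[OF x])
  show "(dS \<xi> \<eta> a \<sigma> n has_vector_derivative deriv (wkb_coeff f n) (of_real x)) (at x within {\<xi>..\<eta>})"
    using eq x by (rule der)
qed

text \<open>Collects what the real-variable part uses of holomorphy, so that the complex
  neighbourhood disappears from here on. \<open>B\<close> and \<open>\<kappa>\<close> are fixed
  before \<open>N\<close>, so the order may depend on \<open>\<epsilon>\<close>, and the bounds may
  also be used with \<open>N = n\<close>.\<close>

locale wkb_bounds =
  fixes \<xi> \<eta> a0 B \<kappa> :: real and a :: "real \<Rightarrow> real" and D :: "complex \<Rightarrow> nat \<Rightarrow> real \<Rightarrow> complex"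
  assumes \<xi>_less_\<eta>: "\<xi> < \<eta>" and a0: "a0 > 0" and a_ge: "x \<in> {\<xi>..\<eta>} \<Longrightarrow> a x \<ge> a0"
    and B: "B > 0" and \<kappa>: "\<kappa> > 0"
    and dS_deriv: "\<lbrakk>\<sigma> \<in> {1, -1}; x \<in> {\<xi>..\<eta>}\<rbrakk> \<Longrightarrow>
      (dS \<xi> \<eta> a \<sigma> n has_vector_derivative D \<sigma> n x) (at x within {\<xi>..\<eta>})"
    and dS_convolution: "\<lbrakk>\<sigma> \<in> {1, -1}; x \<in> {\<xi>..\<eta>}\<rbrakk> \<Longrightarrow>
      (\<Sum>i\<le>Suc n. dS \<xi> \<eta> a \<sigma> i x * dS \<xi> \<eta> a \<sigma> (Suc n - i) x) = - D \<sigma> n x"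
    and dS_le: "\<lbrakk>\<sigma> \<in> {1, -1}; x \<in> {\<xi>..\<eta>}; n \<le> N\<rbrakk> \<Longrightarrow>
      norm (dS \<xi> \<eta> a \<sigma> n x) \<le> B * (\<kappa> * real (Suc N)) ^ n"
    and D_le: "\<lbrakk>\<sigma> \<in> {1, -1}; x \<in> {\<xi>..\<eta>}; n \<le> N\<rbrakk> \<Longrightarrow>
      norm (D \<sigma> n x) \<le> B * (\<kappa> * real (Suc N)) ^ Suc n"

lemma hypothesis_A_imp_wkb_bounds:
  assumes "\<xi> < \<eta>" "a0 > 0" "\<And>x. x \<in> {\<xi>..\<eta>} \<Longrightarrow> a x \<ge> a0" "hypothesis_A \<xi> \<eta> a"
  obtains B \<kappa> D where "wkb_bounds \<xi> \<eta> a0 B \<kappa> a D"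
proof -
  obtain G F where G: "open G" "of_real ` {\<xi>..\<eta>} \<subseteq> G" "F holomorphic_on G"
    and F: "\<And>x. x \<in> {\<xi>..\<eta>} \<Longrightarrow> F (of_real x) = dS \<xi> \<eta> a 1 0 x" and F0: "\<And>z. z \<in> G \<Longrightarrow> F z \<noteq> 0"
    using assms(4) unfolding hypothesis_A_def by blast
  define I where "I = complex_of_real ` {\<xi>..\<eta>}"
  have I: "compact I" "I \<noteq> {}" "I \<subseteq> G"
    using \<open>\<xi> < \<eta>\<close> G by (auto simp: I_def intro!: compact_continuous_image continuous_intros)
  obtain e where e: "e > 0" "(\<Union>z\<in>I. ball z e) \<subseteq> G"
    using compact_subset_open_imp_ball_epsilon_subset[OF I(1) G(1) I(3)] by auto
  \<comment> \<open>Halving the radius makes the closed discs fit into the open ones. Their union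
    \<open>T\<close> is the sum of two compact sets, so \<open>norm (F z)\<close> attains a maximum
    and a positive minimum on it.\<close>
  define \<delta> where "\<delta> = e / 2"
  have \<delta>: "\<delta> > 0" using e by (simp add: \<delta>_def)
  define T where "T = (\<Union>z\<in>I. cball z \<delta>)"
  have T: "compact T" "T \<noteq> {}" "T \<subseteq> G"
  proof -
    have "T = {x + y |x y. x \<in> I \<and> y \<in> cball 0 \<delta>}"
      unfolding T_def cball_def dist_norm
      by (auto, metis add_diff_cancel_left' diff_add_cancel norm_minus_commute add.commute)
    then show "compact T" using compact_sums[OF I(1) compact_cball[of 0 \<delta>]] by simp
    show "T \<noteq> {}" using I \<delta> unfolding T_def by fastforce
    have "cball z \<delta> \<subseteq> ball z e" for z :: complex
      using e by (auto simp: \<delta>_def)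
    then show "T \<subseteq> G" using e(2) unfolding T_def by blast
  qed
  have cont: "continuous_on T (\<lambda>z. norm (F z))"
    using G(3) T(3) by (intro continuous_intros) (auto intro: holomorphic_on_imp_continuous_on holomorphic_on_subset)
  obtain zB where zB: "zB \<in> T" "\<And>z. z \<in> T \<Longrightarrow> norm (F z) \<le> norm (F zB)"
    using continuous_attains_sup[OF T(1,2) cont] by blast
  obtain zm where zm: "zm \<in> T" "\<And>z. z \<in> T \<Longrightarrow> norm (F zm) \<le> norm (F z)"
    using continuous_attains_inf[OF T(1,2) cont] by blast
  define B m where "B = norm (F zB)" and "m = norm (F zm)"
  have m: "m > 0" using F0 T zm by (auto simp: m_def)
  have mB: "m \<le> B" using zB zm by (auto simp: m_def B_def)
  define K where "K = 4 * B / m\<^sup>2 + 1"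
  define \<kappa> where "\<kappa> = K / \<delta>"
  have K: "K \<ge> 1" using m mB by (simp add: K_def)
  \<comment> \<open>Since \<open>\<sigma>\<close> has modulus 1, both branches share the bounds
    \<open>m\<close> and \<open>B\<close>.\<close>
  define f where "f \<sigma> z = \<sigma> * F z" for \<sigma> z
  define D where "D \<sigma> n x = deriv (wkb_coeff (f \<sigma>) n) (complex_of_real x)" for \<sigma> n x
  have f: "f \<sigma> holomorphic_on G" "\<And>z. z \<in> G \<Longrightarrow> f \<sigma> z \<noteq> 0"
      "\<And>x. x \<in> {\<xi>..\<eta>} \<Longrightarrow> f \<sigma> (of_real x) = dS \<xi> \<eta> a \<sigma> 0 x"
      "\<And>z. norm (f \<sigma> z) = norm (F z)" if "\<sigma> \<in> {1, -1}" for \<sigma>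
    unfolding f_def using that G(3) F0 F by (auto intro!: holomorphic_intros)
  have dS_eq: "dS \<xi> \<eta> a \<sigma> n x = wkb_coeff (f \<sigma>) n (of_real x)"
      "(dS \<xi> \<eta> a \<sigma> n has_vector_derivative D \<sigma> n x) (at x within {\<xi>..\<eta>})"
    if "\<sigma> \<in> {1, -1}" "x \<in> {\<xi>..\<eta>}" for \<sigma> n x
    unfolding D_def by (rule dS_eq_wkb_coeff[OF \<open>\<xi> < \<eta>\<close> G(1,2)]; use f that in auto)+
  have disc: "norm (wkb_coeff (f \<sigma>) n z) \<le> B * (\<kappa> * real (Suc N)) ^ n"
    if "\<sigma> \<in> {1, -1}" "x \<in> {\<xi>..\<eta>}" "n \<le> N" "z \<in> cball (of_real x) (\<delta> - real n * (\<delta> / real (Suc N)))"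
    for \<sigma> n N x z
  proof -
    have cT: "cball (of_real x) \<delta> \<subseteq> T" using that unfolding T_def I_def by blast
    show ?thesis
    proof (cases "n = 0")
      case True
      then show ?thesis using that cT zB f(4) by (auto simp: B_def)
    next
      case False
      have "norm (wkb_coeff (f \<sigma>) n z) \<le> m / 8 * (K / (\<delta> / real (Suc N))) ^ n / (real n)\<^sup>2"
      proof (rule norm_wkb_coeff_le[OF G(1) f(1,2)])
        show "m \<le> norm (f \<sigma> w) \<and> norm (f \<sigma> w) \<le> B" if "w \<in> cball (of_real x) \<delta>" for w
          using that cT zB zm f(4)[OF \<open>\<sigma> \<in> {1, -1}\<close>] by (auto simp: B_def m_def)
      qed (use that cT T(3) \<delta> m False in \<open>auto simp: K_def\<close>)
      also have "\<dots> = m / 8 / (real n)\<^sup>2 * (\<kappa> * real (Suc N)) ^ n"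
        by (simp add: \<kappa>_def)
      also have "\<dots> \<le> B * (\<kappa> * real (Suc N)) ^ n"
      proof (rule mult_right_mono)
        have "m / 8 / (real n)\<^sup>2 \<le> m / 8 / 1"
          using False m by (intro divide_left_mono) auto
        then show "m / 8 / (real n)\<^sup>2 \<le> B" using m mB by linarith
      qed (use K \<delta> in \<open>auto simp: \<kappa>_def\<close>)
      finally show ?thesis .
    qed
  qed
  have bound: "norm (wkb_coeff (f \<sigma>) n (of_real x)) \<le> B * (\<kappa> * real (Suc N)) ^ n"
    and dbound: "norm (D \<sigma> n x) \<le> B * (\<kappa> * real (Suc N)) ^ Suc n"
    if "\<sigma> \<in> {1, -1}" "x \<in> {\<xi>..\<eta>}" "n \<le> N" for \<sigma> n N x
  proof -
    \<comment> \<open>Dividing \<open>\<delta>\<close> into \<open>N + 1\<close> steps, not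
      \<open>N\<close>, leaves a disc of radius at least \<open>\<rho>\<close> even for
      \<open>n = N\<close>. That disc pays for the Cauchy estimate of one further
      derivative.\<close>
    define \<rho> where "\<rho> = \<delta> / real (Suc N)"
    have \<rho>: "\<rho> > 0" using \<delta> by (simp add: \<rho>_def)
    have "real (Suc n) * \<rho> \<le> real (Suc N) * \<rho>"
      using that \<rho> by (intro mult_right_mono) auto
    moreover have "real (Suc N) * \<rho> = \<delta>" by (simp add: \<rho>_def)
    ultimately have n\<rho>: "\<rho> \<le> \<delta> - real n * \<rho>" by (simp add: algebra_simps)
    show "norm (wkb_coeff (f \<sigma>) n (of_real x)) \<le> B * (\<kappa> * real (Suc N)) ^ n"
      using that n\<rho> \<rho> by (intro disc[of _ x]) (auto simp: \<rho>_def)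
    have "cball (of_real x) \<rho> \<subseteq> cball (of_real x) \<delta>"
      using n\<rho> \<rho> mult_nonneg_nonneg[of "real n" \<rho>] by (auto simp del: mult_nonneg_nonneg)
    also have "\<dots> \<subseteq> G" using that T(3) unfolding T_def I_def by blast
    finally have "norm (D \<sigma> n x) \<le> B * (\<kappa> * real (Suc N)) ^ n / \<rho>"
      unfolding D_def using that n\<rho> \<rho>
      by (intro norm_deriv_le_Cauchy[OF holomorphic_wkb_coeff[OF G(1) f(1,2)] G(1)] disc[of _ x])
        (auto simp: \<rho>_def)
    also have "\<dots> = B * (\<kappa> * real (Suc N)) ^ n * (1 / \<rho>)"
      by simp
    also have "\<dots> \<le> B * (\<kappa> * real (Suc N)) ^ n * (\<kappa> * real (Suc N))"
    proof (rule mult_left_mono)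
      show "1 / \<rho> \<le> \<kappa> * real (Suc N)"
        using K \<delta> by (simp add: \<rho>_def \<kappa>_def divide_simps mult_right_mono)
    qed (use m mB K \<delta> in \<open>auto simp: \<kappa>_def\<close>)
    finally show "norm (D \<sigma> n x) \<le> B * (\<kappa> * real (Suc N)) ^ Suc n"
      by (simp add: mult_ac)
  qed
  have "wkb_bounds \<xi> \<eta> a0 B \<kappa> a D"
  proof
    show "B > 0" "\<kappa> > 0" using m mB K \<delta> by (auto simp: \<kappa>_def)
    fix \<sigma> :: complex and x n N assume \<sigma>: "\<sigma> \<in> {1, -1}" and x: "x \<in> {\<xi>..\<eta>}"
    show "(dS \<xi> \<eta> a \<sigma> n has_vector_derivative D \<sigma> n x) (at x within {\<xi>..\<eta>})"
      by (rule dS_eq(2)[OF \<sigma> x])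
    show "(\<Sum>i\<le>Suc n. dS \<xi> \<eta> a \<sigma> i x * dS \<xi> \<eta> a \<sigma> (Suc n - i) x) = - D \<sigma> n x"
      unfolding D_def dS_eq(1)[OF \<sigma> x]
      using x G(2) by (intro wkb_coeff_convolution f(2)[OF \<sigma>]) auto
    show "norm (dS \<xi> \<eta> a \<sigma> n x) \<le> B * (\<kappa> * real (Suc N)) ^ n" if "n \<le> N"
      unfolding dS_eq(1)[OF \<sigma> x] using \<sigma> x that by (rule bound)
    show "norm (D \<sigma> n x) \<le> B * (\<kappa> * real (Suc N)) ^ Suc n" if "n \<le> N"
      using \<sigma> x that by (rule dbound)
  qed (use assms in auto)
  then show thesis by (rule that)
qed

subsection \<open>The two WKB branches\<close>

context wkb_bounds
begin

lemma continuous_on_dS: "\<sigma> \<in> {1, -1} \<Longrightarrow> continuous_on {\<xi>..\<eta>} (dS \<xi> \<eta> a \<sigma> n)"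
  by (rule continuous_on_vector_derivative) (rule dS_deriv)

lemma S_has_vector_derivative:
  assumes "\<sigma> \<in> {1, -1}" "x \<in> {\<xi>..\<eta>}"
  shows "(S \<xi> \<eta> a \<sigma> n has_vector_derivative dS \<xi> \<eta> a \<sigma> n x) (at x within {\<xi>..\<eta>})"
  unfolding S_def[abs_def]
  using integral_has_vector_derivative[OF continuous_on_dS] assms by blast

lemma S_left [simp]: "S \<xi> \<eta> a \<sigma> n \<xi> = 0"
  by (simp add: S_def)

lemma norm_S_le:
  assumes "\<sigma> \<in> {1, -1}" "x \<in> {\<xi>..\<eta>}"
  shows "norm (S \<xi> \<eta> a \<sigma> n x) \<le> (\<eta> - \<xi>) * (B * (\<kappa> * real (Suc n)) ^ n)"
proof -
  have "norm (S \<xi> \<eta> a \<sigma> n x) \<le> B * (\<kappa> * real (Suc n)) ^ n * (x - \<xi>)"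
    unfolding S_def using assms
    by (intro integral_bound continuous_on_subset[OF continuous_on_dS] dS_le) auto
  also have "\<dots> \<le> B * (\<kappa> * real (Suc n)) ^ n * (\<eta> - \<xi>)"
    using assms B \<kappa> by (intro mult_left_mono) auto
  finally show ?thesis by (simp add: mult_ac)
qed

text \<open>The leading coefficient is purely imaginary, so the term of size
  \<open>1 / \<epsilon>\<close> in the exponent of \<open>w\<close> is a pure phase.\<close>

lemma Re_S_0:
  assumes "\<sigma> \<in> {1, -1}" "x \<in> {\<xi>..\<eta>}"
  shows "Re (S \<xi> \<eta> a \<sigma> 0 x) = 0"
proof -
  have "dS \<xi> \<eta> a \<sigma> 0 integrable_on {\<xi>..x}"
    using assms by (intro integrable_continuous_interval continuous_on_subset[OF continuous_on_dS]) auto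
  then have "Re (S \<xi> \<eta> a \<sigma> 0 x) = integral {\<xi>..x} (Re \<circ> dS \<xi> \<eta> a \<sigma> 0)"
    unfolding S_def by (rule integral_linear[OF _ bounded_linear_Re, symmetric])
  also have "Re \<circ> dS \<xi> \<eta> a \<sigma> 0 = (\<lambda>_. 0)"
    using assms(1) by (auto simp: fun_eq_iff)
  finally show ?thesis by simp
qed

definition W :: "complex \<Rightarrow> nat \<Rightarrow> real \<Rightarrow> real \<Rightarrow> complex" where
  "W \<sigma> N \<epsilon> x = (\<Sum>n=0..N. complex_of_real (\<epsilon> ^ n) * dS \<xi> \<eta> a \<sigma> n x)"

definition W' :: "complex \<Rightarrow> nat \<Rightarrow> real \<Rightarrow> real \<Rightarrow> complex" where
  "W' \<sigma> N \<epsilon> x = (\<Sum>n=0..N. complex_of_real (\<epsilon> ^ n) * D \<sigma> n x)"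

definition w :: "complex \<Rightarrow> nat \<Rightarrow> real \<Rightarrow> real \<Rightarrow> complex" where
  "w \<sigma> N \<epsilon> x = exp (\<Sum>n=0..N. complex_of_real (\<epsilon> powi (int n - 1)) * S \<xi> \<eta> a \<sigma> n x)"

lemma w_left [simp]: "w \<sigma> N \<epsilon> \<xi> = 1"
  by (simp add: w_def)

lemma dS_0_power2: "\<sigma> \<in> {1, -1} \<Longrightarrow> x \<in> {\<xi>..\<eta>} \<Longrightarrow> (dS \<xi> \<eta> a \<sigma> 0 x)\<^sup>2 = - complex_of_real (a x)"
  using a_ge[of x] a0 by (auto simp: power_mult_distrib simp flip: of_real_power)

lemma W_has_vector_derivative:
  assumes "\<sigma> \<in> {1, -1}" "x \<in> {\<xi>..\<eta>}"
  shows "(W \<sigma> N \<epsilon> has_vector_derivative W' \<sigma> N \<epsilon> x) (at x within {\<xi>..\<eta>})"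
  unfolding W_def[abs_def] W'_def using assms
  by (intro has_vector_derivative_sum has_vector_derivative_mult_right dS_deriv)

lemma w_has_vector_derivative:
  assumes "\<sigma> \<in> {1, -1}" "x \<in> {\<xi>..\<eta>}" "\<epsilon> > 0"
  shows "(w \<sigma> N \<epsilon> has_vector_derivative W \<sigma> N \<epsilon> x / of_real \<epsilon> * w \<sigma> N \<epsilon> x) (at x within {\<xi>..\<eta>})"
proof -
  let ?\<Theta> = "\<lambda>x. \<Sum>n=0..N. complex_of_real (\<epsilon> powi (int n - 1)) * S \<xi> \<eta> a \<sigma> n x"
  have "(?\<Theta> has_vector_derivative (\<Sum>n=0..N. complex_of_real (\<epsilon> powi (int n - 1)) * dS \<xi> \<eta> a \<sigma> n x))
      (at x within {\<xi>..\<eta>})"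
    using assms by (intro has_vector_derivative_sum has_vector_derivative_mult_right S_has_vector_derivative)
  also have "(\<Sum>n=0..N. complex_of_real (\<epsilon> powi (int n - 1)) * dS \<xi> \<eta> a \<sigma> n x) = W \<sigma> N \<epsilon> x / of_real \<epsilon>"
    using \<open>\<epsilon> > 0\<close> by (simp add: W_def sum_divide_distrib power_int_diff)
  finally have "((exp \<circ> ?\<Theta>) has_vector_derivative W \<sigma> N \<epsilon> x / of_real \<epsilon> * exp (?\<Theta> x)) (at x within {\<xi>..\<eta>})"
    by (rule field_vector_diff_chain_within) (auto intro!: derivative_eq_intros)
  then show ?thesis by (simp add: w_def[abs_def] o_def)
qed

lemma w_deriv_has_vector_derivative:
  assumes "\<sigma> \<in> {1, -1}" "x \<in> {\<xi>..\<eta>}" "\<epsilon> > 0"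
  shows "((\<lambda>x. W \<sigma> N \<epsilon> x / of_real \<epsilon> * w \<sigma> N \<epsilon> x) has_vector_derivative
    (W' \<sigma> N \<epsilon> x / of_real \<epsilon> + (W \<sigma> N \<epsilon> x / of_real \<epsilon>)\<^sup>2) * w \<sigma> N \<epsilon> x) (at x within {\<xi>..\<eta>})"
  using has_vector_derivative_mult[OF has_vector_derivative_divide[OF W_has_vector_derivative[OF assms(1,2)]]
      w_has_vector_derivative[OF assms]]
  by (simp add: power2_eq_square algebra_simps)

text \<open>Here the coefficient bounds are used with \<open>N = n\<close>: the bound with the fixed order \<open>N\<close> would
  only give a constant times \<open>1 / \<epsilon>\<close> in the exponent.\<close>

lemma sum_scaled_coeff_bounds_le:
  assumes "\<epsilon> > 0" "\<epsilon> * \<kappa> * real (Suc N) \<le> 1 / 2"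
  shows "(\<Sum>n=1..N. \<epsilon> ^ (n - 1) * (B * (\<kappa> * real (Suc n)) ^ n)) \<le> 6 * B * \<kappa>"
proof -
  have "(\<Sum>n=1..N. \<epsilon> ^ (n - 1) * (B * (\<kappa> * real (Suc n)) ^ n))
      = (\<Sum>k<N. \<epsilon> ^ k * (B * (\<kappa> * real (k + 2)) ^ Suc k))"
    by (rule sum.reindex_bij_witness[of _ Suc "\<lambda>n. n - 1"]) auto
  also have "\<dots> \<le> (\<Sum>k<N. B * \<kappa> * (real (k + 2) / 2 ^ k))"
  proof (rule sum_mono)
    fix k assume k: "k \<in> {..<N}"
    \<comment> \<open>There is one factor \<open>\<kappa> * (k + 2)\<close> more than there are
      factors \<open>\<epsilon>\<close>. It stays as the linear weight, while each of the
      \<open>k\<close> matched pairs is at most \<open>1 / 2\<close>.\<close>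
    have "\<epsilon> * \<kappa> * real (k + 2) \<le> \<epsilon> * \<kappa> * real (Suc N)"
      using k assms \<kappa> by (intro mult_left_mono) auto
    then have "(\<epsilon> * \<kappa> * real (k + 2)) ^ k \<le> (1 / 2) ^ k"
      using order_trans[OF _ assms(2)] assms(1) \<kappa> by (intro power_mono) auto
    then have "B * \<kappa> * real (k + 2) * (\<epsilon> * \<kappa> * real (k + 2)) ^ k \<le> B * \<kappa> * real (k + 2) * (1 / 2) ^ k"
      using B \<kappa> by (intro mult_left_mono) auto
    show "\<epsilon> ^ k * (B * (\<kappa> * real (k + 2)) ^ Suc k) \<le> B * \<kappa> * (real (k + 2) / 2 ^ k)"
    proof -
      have "\<epsilon> ^ k * (B * (\<kappa> * real (k + 2)) ^ Suc k) = B * \<kappa> * real (k + 2) * (\<epsilon> * \<kappa> * real (k + 2)) ^ k"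
        by (simp only: power_Suc power_mult_distrib mult_ac)
      moreover have "B * \<kappa> * real (k + 2) * (1 / 2) ^ k = B * \<kappa> * (real (k + 2) / 2 ^ k)"
        by (simp add: power_one_over)
      ultimately show ?thesis
        using \<open>B * \<kappa> * real (k + 2) * (\<epsilon> * \<kappa> * real (k + 2)) ^ k \<le> B * \<kappa> * real (k + 2) * (1 / 2) ^ k\<close>
        by metis
    qed
  qed
  also have "\<dots> = B * \<kappa> * (\<Sum>k<N. real (k + 2) / 2 ^ k)"
    by (simp add: sum_distrib_left)
  also have "\<dots> \<le> B * \<kappa> * 6"
    using B \<kappa> by (intro mult_left_mono sum_linear_times_half_powers_le) auto
  finally show ?thesis by simp
qed

text \<open>Only the real part of the exponent matters. Its term \<open>n = 0\<close> vanishes, and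
  the remaining terms are bounded uniformly in \<open>\<epsilon>\<close> and
  \<open>N\<close>.\<close>

lemma norm_w_le:
  assumes "\<sigma> \<in> {1, -1}" "x \<in> {\<xi>..\<eta>}" "\<epsilon> > 0" "\<epsilon> * \<kappa> * real (Suc N) \<le> 1 / 2"
  shows "norm (w \<sigma> N \<epsilon> x) \<le> exp ((\<eta> - \<xi>) * (6 * B * \<kappa>))"
proof -
  let ?g = "\<lambda>n. complex_of_real (\<epsilon> powi (int n - 1)) * S \<xi> \<eta> a \<sigma> n x"
  have "Re (\<Sum>n=0..N. ?g n) = (\<Sum>n=0..N. Re (?g n))" by simp
  also have "\<dots> = (\<Sum>n=1..N. Re (?g n))"
    using Re_S_0[OF assms(1,2)] \<open>\<epsilon> > 0\<close> by (subst sum.atLeast_Suc_atMost) (simp_all add: power_int_minus)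
  also have "\<dots> \<le> (\<Sum>n=1..N. (\<eta> - \<xi>) * (\<epsilon> ^ (n - 1) * (B * (\<kappa> * real (Suc n)) ^ n)))"
  proof (rule sum_mono)
    fix n assume n: "n \<in> {1..N}"
    have "Re (?g n) \<le> norm (?g n)" by (rule complex_Re_le_cmod)
    also have "\<dots> = \<epsilon> ^ (n - 1) * norm (S \<xi> \<eta> a \<sigma> n x)"
    proof -
      have "int n - 1 = int (n - 1)" using n by auto
      then show ?thesis
        using \<open>\<epsilon> > 0\<close> by (simp only: power_int_of_nat norm_mult norm_of_real abs_of_nonneg zero_le_power less_imp_le)
    qed
    also have "\<dots> \<le> \<epsilon> ^ (n - 1) * ((\<eta> - \<xi>) * (B * (\<kappa> * real (Suc n)) ^ n))"
      using assms by (intro mult_left_mono norm_S_le) auto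
    finally show "Re (?g n) \<le> (\<eta> - \<xi>) * (\<epsilon> ^ (n - 1) * (B * (\<kappa> * real (Suc n)) ^ n))"
      by (simp add: mult_ac)
  qed
  also have "\<dots> = (\<eta> - \<xi>) * (\<Sum>n=1..N. \<epsilon> ^ (n - 1) * (B * (\<kappa> * real (Suc n)) ^ n))"
    by (simp add: sum_distrib_left)
  also have "\<dots> \<le> (\<eta> - \<xi>) * (6 * B * \<kappa>)"
    using \<xi>_less_\<eta> assms by (intro mult_left_mono sum_scaled_coeff_bounds_le) auto
  finally show ?thesis by (simp add: w_def)
qed

text \<open>The corrections to the leading coefficient stay of order \<open>\<epsilon>\<close>
  although their number grows. This controls \<open>W\<close> from above and the denominator of the
  WKB amplitudes from below.\<close>

lemma norm_W_diff_le:
  assumes "\<sigma> \<in> {1, -1}" "x \<in> {\<xi>..\<eta>}" "\<epsilon> > 0" "\<epsilon> * \<kappa> * real (Suc N) \<le> 1 / 2"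
  shows "norm (W \<sigma> N \<epsilon> x - dS \<xi> \<eta> a \<sigma> 0 x) \<le> \<epsilon> * (6 * B * \<kappa>)"
proof -
  have "W \<sigma> N \<epsilon> x - dS \<xi> \<eta> a \<sigma> 0 x = (\<Sum>n=1..N. complex_of_real (\<epsilon> ^ n) * dS \<xi> \<eta> a \<sigma> n x)"
    by (simp add: W_def sum.atLeast_Suc_atMost)
  also have "norm \<dots> \<le> (\<Sum>n=1..N. \<epsilon> * (\<epsilon> ^ (n - 1) * (B * (\<kappa> * real (Suc n)) ^ n)))"
  proof (rule sum_norm_le)
    fix n assume n: "n \<in> {1..N}"
    have "norm (complex_of_real (\<epsilon> ^ n) * dS \<xi> \<eta> a \<sigma> n x) = \<epsilon> ^ n * norm (dS \<xi> \<eta> a \<sigma> n x)"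
      using \<open>\<epsilon> > 0\<close> by (simp add: norm_mult norm_power)
    also have "\<dots> \<le> \<epsilon> ^ n * (B * (\<kappa> * real (Suc n)) ^ n)"
      using assms by (intro mult_left_mono dS_le) auto
    also have "\<dots> = \<epsilon> * \<epsilon> ^ (n - 1) * (B * (\<kappa> * real (Suc n)) ^ n)"
      using n by (simp flip: power_Suc)
    finally show "norm (complex_of_real (\<epsilon> ^ n) * dS \<xi> \<eta> a \<sigma> n x)
        \<le> \<epsilon> * (\<epsilon> ^ (n - 1) * (B * (\<kappa> * real (Suc n)) ^ n))"
      by (simp only: mult.assoc)
  qed
  also have "\<dots> = \<epsilon> * (\<Sum>n=1..N. \<epsilon> ^ (n - 1) * (B * (\<kappa> * real (Suc n)) ^ n))"
    by (simp add: sum_distrib_left)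
  also have "\<dots> \<le> \<epsilon> * (6 * B * \<kappa>)"
    using assms by (intro mult_left_mono sum_scaled_coeff_bounds_le) auto
  finally show ?thesis .
qed

text \<open>Here the coefficient bounds are taken at the fixed order \<open>N\<close>: they give a
  geometric majorant with ratio \<open>y \<le> 1 / 2\<close>, which plays the role of
  \<open>x\<close> in \<open>riccati_residual_le\<close>.\<close>

lemma norm_residual_le:
  assumes \<sigma>: "\<sigma> \<in> {1, -1}" and x: "x \<in> {\<xi>..\<eta>}" and \<epsilon>: "\<epsilon> > 0" "\<epsilon> * \<kappa> * real (Suc N) \<le> 1 / 2"
  shows "norm ((W \<sigma> N \<epsilon> x)\<^sup>2 + of_real \<epsilon> * W' \<sigma> N \<epsilon> x + of_real (a x))
    \<le> (B + (real (Suc N) * B)\<^sup>2) * (1 / 2) ^ Suc N"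
proof -
  define y where "y = \<epsilon> * (\<kappa> * real (Suc N))"
  have y: "0 \<le> y" "y \<le> 1 / 2" using \<epsilon> \<kappa> by (auto simp: y_def mult.assoc)
  define q where "q n = complex_of_real (\<epsilon> ^ n) * dS \<xi> \<eta> a \<sigma> n x" for n
  define q' where "q' n = complex_of_real (\<epsilon> ^ n) * D \<sigma> n x" for n
  have "norm ((\<Sum>n\<le>N. q n)\<^sup>2 + of_real \<epsilon> * (\<Sum>n\<le>N. q' n) + of_real (a x))
      \<le> (B + (real (Suc N) * B)\<^sup>2) * y ^ Suc N"
  proof (rule riccati_residual_le)
    show "(q 0)\<^sup>2 = - of_real (a x)"
      using dS_0_power2[OF \<sigma> x] by (simp add: q_def)
    show "(\<Sum>i\<le>Suc k. q i * q (Suc k - i)) = - (of_real \<epsilon> * q' k)" for k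
    proof -
      have "(\<Sum>i\<le>Suc k. q i * q (Suc k - i))
          = (\<Sum>i\<le>Suc k. complex_of_real (\<epsilon> ^ Suc k) * (dS \<xi> \<eta> a \<sigma> i x * dS \<xi> \<eta> a \<sigma> (Suc k - i) x))"
      proof (rule sum.cong)
        fix i assume "i \<in> {..Suc k}"
        then have "complex_of_real (\<epsilon> ^ Suc k) = complex_of_real (\<epsilon> ^ i) * complex_of_real (\<epsilon> ^ (Suc k - i))"
          by (simp only: of_real_mult[symmetric] power_add[symmetric]) simp
        then show "q i * q (Suc k - i)
            = complex_of_real (\<epsilon> ^ Suc k) * (dS \<xi> \<eta> a \<sigma> i x * dS \<xi> \<eta> a \<sigma> (Suc k - i) x)"
          by (simp add: q_def mult_ac)
      qed simp
      also have "\<dots> = complex_of_real (\<epsilon> ^ Suc k) * (- D \<sigma> k x)"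
        by (simp only: sum_distrib_left[symmetric] dS_convolution[OF \<sigma> x])
      finally show ?thesis by (simp add: q'_def)
    qed
    show "norm (q n) \<le> B * y ^ n" if "n \<le> N" for n
    proof -
      have "norm (q n) = \<epsilon> ^ n * norm (dS \<xi> \<eta> a \<sigma> n x)"
        using \<epsilon> by (simp add: q_def norm_mult norm_power)
      also have "\<dots> \<le> \<epsilon> ^ n * (B * (\<kappa> * real (Suc N)) ^ n)"
        using \<epsilon> that by (intro mult_left_mono dS_le \<sigma> x) auto
      finally show ?thesis by (simp only: y_def power_mult_distrib mult_ac)
    qed
    have "norm (of_real \<epsilon> * q' N) = \<epsilon> ^ Suc N * norm (D \<sigma> N x)"
      using \<epsilon> by (simp add: q'_def norm_mult norm_power)
    also have "\<dots> \<le> \<epsilon> ^ Suc N * (B * (\<kappa> * real (Suc N)) ^ Suc N)"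
      using \<epsilon> by (intro mult_left_mono D_le \<sigma> x) auto
    finally show "norm (of_real \<epsilon> * q' N) \<le> B * y ^ Suc N"
      by (simp only: y_def power_mult_distrib mult_ac)
  qed (use y in auto)
  also have "\<dots> \<le> (B + (real (Suc N) * B)\<^sup>2) * (1 / 2) ^ Suc N"
    using y B by (intro mult_left_mono power_mono) auto
  finally show ?thesis by (simp add: W_def W'_def q_def q'_def atMost_atLeast0)
qed

text \<open>Differentiability of \<open>a\<close> is inherited from the leading coefficient, whose
  square is \<open>- a\<close>. The bound on the derivative, from the estimates with
  \<open>N = 0\<close>, is the constant \<open>A\<close> of the energy estimate.\<close>

lemma a_has_real_derivative:
  assumes "x \<in> {\<xi>..\<eta>}"
  shows "(a has_real_derivative Re (- 2 * dS \<xi> \<eta> a 1 0 x * D 1 0 x)) (at x within {\<xi>..\<eta>})"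
    and "\<bar>Re (- 2 * dS \<xi> \<eta> a 1 0 x * D 1 0 x)\<bar> \<le> 2 * B * (B * \<kappa>)"
proof -
  have "((\<lambda>x. - (dS \<xi> \<eta> a 1 0 x * dS \<xi> \<eta> a 1 0 x)) has_vector_derivative
      - 2 * dS \<xi> \<eta> a 1 0 x * D 1 0 x) (at x within {\<xi>..\<eta>})"
    using has_vector_derivative_minus[OF has_vector_derivative_mult[OF dS_deriv dS_deriv, of 1 x 1 0 0]] assms
    by (simp add: algebra_simps del: dS.simps)
  note bounded_linear.has_vector_derivative[OF bounded_linear_Re this]
  moreover have "a x = Re (- (dS \<xi> \<eta> a 1 0 x * dS \<xi> \<eta> a 1 0 x))" if "x \<in> {\<xi>..\<eta>}" for x
    using dS_0_power2[OF _ that, of 1] by (simp add: power2_eq_square del: dS.simps)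
  ultimately show "(a has_real_derivative Re (- 2 * dS \<xi> \<eta> a 1 0 x * D 1 0 x)) (at x within {\<xi>..\<eta>})"
    unfolding has_real_derivative_iff_has_vector_derivative
    using assms by (rule_tac has_vector_derivative_transform) auto
  have "norm (dS \<xi> \<eta> a 1 0 x) \<le> B" "norm (D 1 0 x) \<le> B * \<kappa>"
    using dS_le[of 1 x 0 0] D_le[of 1 x 0 0] assms by auto
  then have "norm (dS \<xi> \<eta> a 1 0 x) * norm (D 1 0 x) \<le> B * (B * \<kappa>)"
    using B by (intro mult_mono) auto
  then have "norm (- 2 * dS \<xi> \<eta> a 1 0 x * D 1 0 x) \<le> 2 * B * (B * \<kappa>)"
    by (simp add: norm_mult del: dS.simps)
  then show "\<bar>Re (- 2 * dS \<xi> \<eta> a 1 0 x * D 1 0 x)\<bar> \<le> 2 * B * (B * \<kappa>)"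
    by (rule order_trans[OF abs_Re_le_cmod])
qed

end

subsection \<open>The WKB approximation\<close>

context wkb_bounds
begin

lemma \<phi>_WKB_eq:
  "\<phi>_WKB \<xi> \<eta> a \<phi>0 \<phi>1 N \<epsilon> x =
    \<alpha>_WKB \<xi> \<eta> a \<phi>0 \<phi>1 N \<epsilon> * w (-1) N \<epsilon> x + \<beta>_WKB \<xi> \<eta> a \<phi>0 \<phi>1 N \<epsilon> * w 1 N \<epsilon> x"
  by (simp add: \<phi>_WKB_def w_def)

lemma \<alpha>_WKB_eq: "\<alpha>_WKB \<xi> \<eta> a \<phi>0 \<phi>1 N \<epsilon> =
    (\<phi>0 * W 1 N \<epsilon> \<xi> - \<phi>1) / (W 1 N \<epsilon> \<xi> - W (-1) N \<epsilon> \<xi>)"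
  by (simp only: \<alpha>_WKB_def W_def right_diff_distrib sum_subtractf)

lemma \<beta>_WKB_eq: "\<beta>_WKB \<xi> \<eta> a \<phi>0 \<phi>1 N \<epsilon> =
    (\<phi>1 - \<phi>0 * W (-1) N \<epsilon> \<xi>) / (W 1 N \<epsilon> \<xi> - W (-1) N \<epsilon> \<xi>)"
  by (simp only: \<beta>_WKB_def W_def right_diff_distrib sum_subtractf)

lemma \<phi>_WKB_has_vector_derivative:
  assumes "x \<in> {\<xi>..\<eta>}" "\<epsilon> > 0"
  shows "(\<phi>_WKB \<xi> \<eta> a \<phi>0 \<phi>1 N \<epsilon> has_vector_derivative
      \<alpha>_WKB \<xi> \<eta> a \<phi>0 \<phi>1 N \<epsilon> * (W (-1) N \<epsilon> x / of_real \<epsilon> * w (-1) N \<epsilon> x) +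
      \<beta>_WKB \<xi> \<eta> a \<phi>0 \<phi>1 N \<epsilon> * (W 1 N \<epsilon> x / of_real \<epsilon> * w 1 N \<epsilon> x)) (at x within {\<xi>..\<eta>})"
  unfolding \<phi>_WKB_eq[abs_def] using assms
  by (intro has_vector_derivative_add has_vector_derivative_mult_right w_has_vector_derivative) auto

lemma norm_W_le:
  assumes "\<sigma> \<in> {1, -1}" "x \<in> {\<xi>..\<eta>}" "0 < \<epsilon>" "\<epsilon> \<le> 1" "\<epsilon> * \<kappa> * real (Suc N) \<le> 1 / 2"
  shows "norm (W \<sigma> N \<epsilon> x) \<le> B + 6 * B * \<kappa>"
proof -
  have "norm (W \<sigma> N \<epsilon> x) \<le> norm (dS \<xi> \<eta> a \<sigma> 0 x) + norm (W \<sigma> N \<epsilon> x - dS \<xi> \<eta> a \<sigma> 0 x)"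
    by (rule norm_triangle_sub)
  also have "norm (dS \<xi> \<eta> a \<sigma> 0 x) \<le> B"
    using dS_le[OF assms(1,2), of 0 0] by simp
  also have "norm (W \<sigma> N \<epsilon> x - dS \<xi> \<eta> a \<sigma> 0 x) \<le> \<epsilon> * (6 * B * \<kappa>)"
    using assms by (intro norm_W_diff_le)
  also have "\<dots> \<le> 1 * (6 * B * \<kappa>)"
    using assms B \<kappa> by (intro mult_right_mono) auto
  finally show ?thesis by simp
qed

text \<open>The leading coefficients of the two branches differ by \<open>2 * sqrt (a x)\<close> in
  modulus, and the two corrections together remove at most
  \<open>12 * B * \<kappa> * \<epsilon>\<close>, hence at most half of
  \<open>2 * sqrt a0\<close>.\<close>

lemma norm_W_minus_W_ge:
  assumes "x \<in> {\<xi>..\<eta>}" "0 < \<epsilon>" "\<epsilon> * \<kappa> * real (Suc N) \<le> 1 / 2" "12 * B * \<kappa> * \<epsilon> \<le> sqrt a0"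
  shows "sqrt a0 \<le> norm (W 1 N \<epsilon> x - W (-1) N \<epsilon> x)"
proof -
  let ?p = "\<lambda>\<sigma>. dS \<xi> \<eta> a \<sigma> 0 x"
  have "?p 1 - ?p (-1) = 2 * \<i> * complex_of_real (sqrt (a x))" by simp
  then have "norm (?p 1 - ?p (-1)) = 2 * sqrt (a x)"
    using a_ge[OF assms(1)] a0 by (simp only: norm_mult norm_of_real) simp
  moreover have "sqrt a0 \<le> sqrt (a x)" using a_ge[OF assms(1)] by simp
  ultimately have p: "2 * sqrt a0 \<le> norm (?p 1 - ?p (-1))" by linarith
  have d: "norm (W \<sigma> N \<epsilon> x - ?p \<sigma>) \<le> 6 * B * \<kappa> * \<epsilon>" if "\<sigma> \<in> {1, -1}" for \<sigma>
    using norm_W_diff_le[OF that assms(1-3)] by (simp add: mult_ac)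
  have eq: "?p 1 - ?p (-1) = (W 1 N \<epsilon> x - W (-1) N \<epsilon> x) - (W 1 N \<epsilon> x - ?p 1) + (W (-1) N \<epsilon> x - ?p (-1))"
    by (simp del: dS.simps)
  have "norm (?p 1 - ?p (-1))
      \<le> norm (W 1 N \<epsilon> x - W (-1) N \<epsilon> x) + norm (W 1 N \<epsilon> x - ?p 1) + norm (W (-1) N \<epsilon> x - ?p (-1))"
    unfolding eq by (intro order_trans[OF norm_triangle_ineq] add_mono norm_triangle_ineq4 order_refl)
  also have "\<dots> \<le> norm (W 1 N \<epsilon> x - W (-1) N \<epsilon> x) + 6 * B * \<kappa> * \<epsilon> + 6 * B * \<kappa> * \<epsilon>"
    by (intro add_mono d order_refl) auto
  finally show ?thesis using p assms(4) by linarith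
qed

text \<open>The constant of the energy estimate times the bounds for two amplitudes and two
  exponentials. It contains neither \<open>\<epsilon>\<close> nor the order
  \<open>N\<close>.\<close>

definition error_const :: "real \<Rightarrow> real" where
  "error_const M = sqrt ((\<eta> - \<xi>) * exp ((1 + 2 * B * (B * \<kappa>) / a0) * (\<eta> - \<xi>)) / a0) *
     (2 * (M * (1 + (B + 6 * B * \<kappa>)) / sqrt a0) * exp ((\<eta> - \<xi>) * (6 * B * \<kappa>)))"

text \<open>The amplitudes are chosen so that the difference \<open>\<psi>\<close> has zero initial
  data, and its residual is the combination of the two branch residuals. The energy estimate
  therefore applies and costs one factor \<open>1 / \<epsilon>\<close>.\<close>

lemma norm_ivp_solution_minus_\<phi>_WKB_le:
  assumes \<epsilon>: "0 < \<epsilon>" "\<epsilon> \<le> 1" "\<epsilon> * \<kappa> * real (Suc N) \<le> 1 / 2" "12 * B * \<kappa> * \<epsilon> \<le> sqrt a0"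
    and "ivp_solution \<xi> \<eta> a \<epsilon> \<phi>0 \<phi>1 \<phi>" and M: "norm \<phi>0 \<le> M" "norm \<phi>1 \<le> M"
    and x: "x \<in> {\<xi>..\<eta>}"
  shows "norm (\<phi> x - \<phi>_WKB \<xi> \<eta> a \<phi>0 \<phi>1 N \<epsilon> x)
    \<le> error_const M * ((B + (real (Suc N) * B)\<^sup>2) * (1 / 2) ^ Suc N / \<epsilon>)"
proof -
  obtain \<phi>' \<phi>'' where
    d1: "\<And>x. x \<in> {\<xi>..\<eta>} \<Longrightarrow> (\<phi> has_vector_derivative \<phi>' x) (at x within {\<xi>..\<eta>})"
    and d2: "\<And>x. x \<in> {\<xi>..\<eta>} \<Longrightarrow> (\<phi>' has_vector_derivative \<phi>'' x) (at x within {\<xi>..\<eta>})"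
    and ode: "\<And>x. x \<in> {\<xi>..\<eta>} \<Longrightarrow> of_real (\<epsilon>\<^sup>2) * \<phi>'' x + of_real (a x) * \<phi> x = 0"
    and init: "\<phi> \<xi> = \<phi>0" "of_real \<epsilon> * \<phi>' \<xi> = \<phi>1"
    using assms(5) unfolding ivp_solution_def by blast
  define A where "A \<sigma> = (if \<sigma> = 1 then \<beta>_WKB \<xi> \<eta> a \<phi>0 \<phi>1 N \<epsilon> else \<alpha>_WKB \<xi> \<eta> a \<phi>0 \<phi>1 N \<epsilon>)"
    for \<sigma> :: complex
  define u' where "u' \<sigma> x = W \<sigma> N \<epsilon> x / of_real \<epsilon> * w \<sigma> N \<epsilon> x" for \<sigma> x
  define u'' where "u'' \<sigma> x = (W' \<sigma> N \<epsilon> x / of_real \<epsilon> + (W \<sigma> N \<epsilon> x / of_real \<epsilon>)\<^sup>2) * w \<sigma> N \<epsilon> x" for \<sigma> x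
  define Q where "Q = (B + (real (Suc N) * B)\<^sup>2) * (1 / 2) ^ Suc N"
  define L where "L = exp ((\<eta> - \<xi>) * (6 * B * \<kappa>))"
  define c where "c = M * (1 + (B + 6 * B * \<kappa>)) / sqrt a0"
  have \<xi>: "\<xi> \<in> {\<xi>..\<eta>}" using \<xi>_less_\<eta> by simp
  have M0: "M \<ge> 0" using M norm_ge_zero order_trans by blast
  have Q0: "Q \<ge> 0" using B by (simp add: Q_def)
  have den: "sqrt a0 \<le> norm (W 1 N \<epsilon> \<xi> - W (-1) N \<epsilon> \<xi>)"
    using \<epsilon> by (intro norm_W_minus_W_ge \<xi>) auto
  then have den0: "W 1 N \<epsilon> \<xi> - W (-1) N \<epsilon> \<xi> \<noteq> 0" using a0 by auto
  have num: "norm (\<phi>0 * W \<sigma> N \<epsilon> \<xi>) \<le> M * (B + 6 * B * \<kappa>)" if "\<sigma> \<in> {1, -1}" for \<sigma>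
    unfolding norm_mult using M M0 \<epsilon> that by (intro mult_mono norm_W_le \<xi>) auto
  have A_le: "norm (A \<sigma>) \<le> c" if "\<sigma> \<in> {1, -1}" for \<sigma>
  proof -
    have "norm (\<phi>0 * W 1 N \<epsilon> \<xi> - \<phi>1) \<le> M * (1 + (B + 6 * B * \<kappa>))"
      using norm_triangle_ineq4[of "\<phi>0 * W 1 N \<epsilon> \<xi>" \<phi>1] num[of 1] M by (simp add: algebra_simps)
    moreover have "norm (\<phi>1 - \<phi>0 * W (-1) N \<epsilon> \<xi>) \<le> M * (1 + (B + 6 * B * \<kappa>))"
      using norm_triangle_ineq4[of \<phi>1 "\<phi>0 * W (-1) N \<epsilon> \<xi>"] num[of "-1"] M by (simp add: algebra_simps)
    ultimately show ?thesis
      using den a0 B \<kappa> M0 unfolding A_def c_def \<alpha>_WKB_eq \<beta>_WKB_eq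
      by (auto simp: norm_divide intro!: frac_le)
  qed
  define \<psi> where "\<psi> x = \<phi> x - \<phi>_WKB \<xi> \<eta> a \<phi>0 \<phi>1 N \<epsilon> x" for x
  define \<psi>' where "\<psi>' x = \<phi>' x - (A (-1) * u' (-1) x + A 1 * u' 1 x)" for x
  define \<psi>'' where "\<psi>'' x = \<phi>'' x - (A (-1) * u'' (-1) x + A 1 * u'' 1 x)" for x
  have "norm (\<psi> x) \<le> sqrt ((\<eta> - \<xi>) * exp ((1 + 2 * B * (B * \<kappa>) / a0) * (\<eta> - \<xi>)) / a0) *
      (2 * c * L * Q / \<epsilon>)"
  proof (rule oscillator_energy_estimate[where \<psi>' = \<psi>' and \<psi>'' = \<psi>''])
    show "0 \<le> 2 * c * L * Q" using M0 a0 B \<kappa> Q0 by (simp add: c_def L_def)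
    fix x assume x: "x \<in> {\<xi>..\<eta>}"
    show "(\<psi> has_vector_derivative \<psi>' x) (at x within {\<xi>..\<eta>})"
      unfolding \<psi>_def[abs_def] \<psi>'_def A_def u'_def
      using has_vector_derivative_diff[OF d1[OF x] \<phi>_WKB_has_vector_derivative[OF x \<epsilon>(1)]] by simp
    show "(\<psi>' has_vector_derivative \<psi>'' x) (at x within {\<xi>..\<eta>})"
      unfolding \<psi>'_def[abs_def] \<psi>''_def u'_def u''_def
      using x \<epsilon>(1)
      by (intro has_vector_derivative_diff has_vector_derivative_add has_vector_derivative_mult_right
          d2 w_deriv_has_vector_derivative) auto
    show "norm (of_real (\<epsilon>\<^sup>2) * \<psi>'' x + of_real (a x) * \<psi> x) \<le> 2 * c * L * Q"
    proof -
      define r where "r \<sigma> = ((W \<sigma> N \<epsilon> x)\<^sup>2 + of_real \<epsilon> * W' \<sigma> N \<epsilon> x + of_real (a x)) * w \<sigma> N \<epsilon> x" for \<sigma>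
      have r: "of_real (\<epsilon>\<^sup>2) * u'' \<sigma> x + of_real (a x) * w \<sigma> N \<epsilon> x = r \<sigma>" for \<sigma>
        using \<epsilon>(1) by (simp add: u''_def r_def power2_eq_square field_simps)
      have "of_real (\<epsilon>\<^sup>2) * \<psi>'' x + of_real (a x) * \<psi> x
          = (of_real (\<epsilon>\<^sup>2) * \<phi>'' x + of_real (a x) * \<phi> x) - (A (-1) * r (-1) + A 1 * r 1)"
        unfolding r[symmetric] \<psi>''_def \<psi>_def \<phi>_WKB_eq by (simp add: A_def algebra_simps)
      also have "\<dots> = - (A (-1) * r (-1)) - A 1 * r 1"
        using ode[OF x] by simp
      finally have eq: "of_real (\<epsilon>\<^sup>2) * \<psi>'' x + of_real (a x) * \<psi> x = - (A (-1) * r (-1)) - A 1 * r 1" .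
      have "norm (A \<sigma> * r \<sigma>) \<le> c * (Q * L)" if \<sigma>: "\<sigma> \<in> {1, -1}" for \<sigma>
      proof -
        have "norm (r \<sigma>) \<le> Q * L"
          unfolding r_def Q_def L_def norm_mult using \<sigma> x \<epsilon> B
          by (intro mult_mono norm_residual_le norm_w_le) auto
        then show ?thesis
          unfolding norm_mult using A_le[OF \<sigma>] order_trans[OF norm_ge_zero A_le[OF \<sigma>]]
          by (intro mult_mono) auto
      qed
      from this[of 1] this[of "-1"] show ?thesis
        unfolding eq using norm_triangle_ineq4[of "- (A (-1) * r (-1))" "A 1 * r 1"]
        by (simp add: mult_ac)
    qed
  next
    have "\<alpha>_WKB \<xi> \<eta> a \<phi>0 \<phi>1 N \<epsilon> + \<beta>_WKB \<xi> \<eta> a \<phi>0 \<phi>1 N \<epsilon>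
        = \<phi>0 * (W 1 N \<epsilon> \<xi> - W (-1) N \<epsilon> \<xi>) / (W 1 N \<epsilon> \<xi> - W (-1) N \<epsilon> \<xi>)"
      unfolding \<alpha>_WKB_eq \<beta>_WKB_eq add_divide_distrib[symmetric] by (simp add: algebra_simps)
    also have "\<dots> = \<phi>0" using den0 by simp
    finally show "\<psi> \<xi> = 0" by (simp add: \<psi>_def \<phi>_WKB_eq init)
    have "A (-1) * W (-1) N \<epsilon> \<xi> + A 1 * W 1 N \<epsilon> \<xi>
        = ((\<phi>0 * W 1 N \<epsilon> \<xi> - \<phi>1) * W (-1) N \<epsilon> \<xi> + (\<phi>1 - \<phi>0 * W (-1) N \<epsilon> \<xi>) * W 1 N \<epsilon> \<xi>) /
          (W 1 N \<epsilon> \<xi> - W (-1) N \<epsilon> \<xi>)"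
      by (simp add: A_def \<alpha>_WKB_eq \<beta>_WKB_eq add_divide_distrib)
    also have "\<dots> = \<phi>1 * (W 1 N \<epsilon> \<xi> - W (-1) N \<epsilon> \<xi>) / (W 1 N \<epsilon> \<xi> - W (-1) N \<epsilon> \<xi>)"
      by (simp add: algebra_simps)
    also have "\<dots> = \<phi>1" using den0 by simp
    finally have "A (-1) * W (-1) N \<epsilon> \<xi> + A 1 * W 1 N \<epsilon> \<xi> = \<phi>1" .
    moreover have "\<psi>' \<xi> = (of_real \<epsilon> * \<phi>' \<xi> - (A (-1) * W (-1) N \<epsilon> \<xi> + A 1 * W 1 N \<epsilon> \<xi>)) / of_real \<epsilon>"
      using \<epsilon>(1) by (simp add: \<psi>'_def u'_def field_simps)
    ultimately show "\<psi>' \<xi> = 0" using init by simp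
  qed (use \<epsilon> a0 a_ge x a_has_real_derivative in auto)
  then show ?thesis
    by (simp add: \<psi>_def error_const_def Q_def L_def c_def mult_ac)
qed

end

section \<open>Optimal truncation and the exponential bound\<close>

lemma Linf_norm_le:
  assumes "continuous_on {a..b} f" "\<And>x. x \<in> {a..b} \<Longrightarrow> norm (f x) \<le> C"
  shows "Linf_norm {a..b} f \<le> ereal C"
proof -
  have "continuous_on {a..b} (\<lambda>x. norm (f x))"
    using assms(1) by (intro continuous_intros)
  then have "(\<lambda>x. norm (f x)) \<in> borel_measurable (lebesgue_on {a..b})"
    by (intro continuous_imp_measurable_on_sets_lebesgue) auto
  then show ?thesis
    unfolding Linf_norm_def using assms(2)
    by (intro esssup_I) (auto intro!: AE_I2)
qed

lemma exists_order_of_truncation: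
  fixes b :: real
  assumes "b > 0"
  obtains N :: "real \<Rightarrow> nat" where
    "\<And>\<epsilon>. \<lbrakk>0 < \<epsilon>; \<epsilon> \<le> b / 2\<rbrakk> \<Longrightarrow> N \<epsilon> \<ge> 1 \<and> \<epsilon> * real (Suc (N \<epsilon>)) \<le> b \<and> b / \<epsilon> \<le> real (Suc (N \<epsilon>)) + 1"
proof
  fix \<epsilon> :: real assume \<epsilon>: "0 < \<epsilon>" "\<epsilon> \<le> b / 2"
  \<comment> \<open>The order is chosen with \<open>N + 1\<close> the integer part of
    \<open>b / \<epsilon>\<close>; the restriction \<open>\<epsilon> \<le> b / 2\<close> makes this
    at least 2, so that \<open>N \<ge> 1\<close>.\<close>
  define k where "k = nat \<lfloor>b / \<epsilon>\<rfloor>"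
  have "b / \<epsilon> \<ge> 2" using \<epsilon> by (simp add: field_simps)
  then have k: "k \<ge> 2" "real k \<le> b / \<epsilon>" "b / \<epsilon> \<le> real k + 1"
    unfolding k_def by linarith+
  then show "k - 1 \<ge> 1 \<and> \<epsilon> * real (Suc (k - 1)) \<le> b \<and> b / \<epsilon> \<le> real (Suc (k - 1)) + 1"
    using \<epsilon> by (auto simp: field_simps)
qed

lemma inverse_cube_le_exp:
  fixes r \<epsilon> :: real
  assumes "r > 0" "\<epsilon> > 0"
  shows "1 / \<epsilon> ^ 3 \<le> 27 / r ^ 3 * exp (r / \<epsilon>)"
proof -
  have "r / (3 * \<epsilon>) \<le> exp (r / (3 * \<epsilon>))"
    using exp_ge_add_one_self[of "r / (3 * \<epsilon>)"] by linarith
  then have "(r / (3 * \<epsilon>)) ^ 3 \<le> exp (r / (3 * \<epsilon>)) ^ 3"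
    using assms by (intro power_mono) auto
  also have "\<dots> = exp (r / \<epsilon>)" by (simp flip: exp_of_nat_mult)
  finally show ?thesis
    using assms by (simp add: power_divide power_mult_distrib field_simps)
qed

text \<open>Here \<open>k\<close> stands for \<open>N + 1\<close>. The power of \<open>1 / 2\<close>
  decays like \<open>exp (- 2 * r / \<epsilon>)\<close>, and half of this rate is sacrificed to
  absorb \<open>1 / \<epsilon>^3\<close>: two powers come from
  \<open>k \<le> b / \<epsilon>\<close>, one from the energy estimate. The factor 54 is 2, from
  rounding \<open>b / \<epsilon>\<close> to an integer, times 27 from
  \<open>inverse_cube_le_exp\<close>.\<close>

lemma truncation_error_le:
  fixes b B \<epsilon> :: real
  assumes "b > 0" "B > 0" "0 < \<epsilon>" "\<epsilon> \<le> 1"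
    and k: "\<epsilon> * real k \<le> b" "b / \<epsilon> \<le> real k + 1"
  defines "r \<equiv> b * ln 2 / 2"
  shows "(B + (real k * B)\<^sup>2) * (1 / 2) ^ k / \<epsilon> \<le> (B + (b * B)\<^sup>2) * 54 / r ^ 3 * exp (- r / \<epsilon>)"
proof -
  have r: "r > 0" using assms by (simp add: r_def)
  have "(\<epsilon> * real k * B)\<^sup>2 \<le> (b * B)\<^sup>2"
    using assms by (intro power_mono mult_right_mono) auto
  moreover have "\<epsilon>\<^sup>2 * B \<le> 1 * B"
    using assms by (intro mult_right_mono) (auto simp: power_le_one)
  ultimately have "\<epsilon>\<^sup>2 * (B + (real k * B)\<^sup>2) \<le> B + (b * B)\<^sup>2"
    by (simp add: power_mult_distrib algebra_simps)
  then have poly: "B + (real k * B)\<^sup>2 \<le> (B + (b * B)\<^sup>2) / \<epsilon>\<^sup>2"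
    using assms by (simp add: pos_le_divide_eq mult.commute)
  have "(1 / 2) ^ k = exp (- ln 2 :: real) ^ k"
    by (simp add: exp_minus)
  also have "\<dots> = exp (- ln 2 * real k)"
    by (rule exp_of_nat2_mult[symmetric])
  also have "\<dots> \<le> exp (ln 2 - 2 * r / \<epsilon>)"
  proof -
    have "ln 2 * (b / \<epsilon>) \<le> ln 2 * (real k + 1)"
      using k by (intro mult_left_mono) auto
    then show ?thesis by (simp add: r_def algebra_simps)
  qed
  also have "\<dots> = 2 * exp (- 2 * r / \<epsilon>)"
    by (simp add: exp_diff exp_minus divide_inverse)
  finally have "(B + (real k * B)\<^sup>2) * (1 / 2) ^ k / \<epsilon>
      \<le> (B + (b * B)\<^sup>2) / \<epsilon>\<^sup>2 * (2 * exp (- 2 * r / \<epsilon>)) / \<epsilon>"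
    using poly assms by (intro divide_right_mono mult_mono) auto
  also have "\<dots> = (B + (b * B)\<^sup>2) * 2 * (1 / \<epsilon> ^ 3) * exp (- 2 * r / \<epsilon>)"
    by (simp add: power2_eq_square power3_eq_cube)
  also have "\<dots> \<le> (B + (b * B)\<^sup>2) * 2 * (27 / r ^ 3 * exp (r / \<epsilon>)) * exp (- 2 * r / \<epsilon>)"
    using assms r by (intro mult_right_mono mult_left_mono inverse_cube_le_exp) auto
  also have "\<dots> = (B + (b * B)\<^sup>2) * 54 / r ^ 3 * (exp (r / \<epsilon>) * exp (- 2 * r / \<epsilon>))"
    by simp
  also have "exp (r / \<epsilon>) * exp (- 2 * r / \<epsilon>) = exp (- r / \<epsilon>)"
    by (simp flip: exp_add add_divide_distrib)
  finally show ?thesis .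
qed

theorem corollary4p1:
  fixes \<xi> \<eta> a0 M :: real and a :: "real \<Rightarrow> real"
    and \<phi>0 \<phi>1 :: "real \<Rightarrow> complex" and \<phi> :: "real \<Rightarrow> real \<Rightarrow> complex"
  assumes "\<xi> < \<eta>"
    and "a0 > 0" and "\<And>x. x \<in> {\<xi>..\<eta>} \<Longrightarrow> a x \<ge> a0"
    and "\<And>\<epsilon>. \<epsilon> \<in> {0<..<1} \<Longrightarrow> cmod (\<phi>0 \<epsilon>) \<le> M"
    and "\<And>\<epsilon>. \<epsilon> \<in> {0<..<1} \<Longrightarrow> cmod (\<phi>1 \<epsilon>) \<le> M"
    and "hypothesis_A \<xi> \<eta> a"
    and "\<And>\<epsilon>. \<epsilon> \<in> {0<..<1} \<Longrightarrow> ivp_solution \<xi> \<eta> a \<epsilon> (\<phi>0 \<epsilon>) (\<phi>1 \<epsilon>) (\<phi> \<epsilon>)"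
  shows "\<exists>\<epsilon>0 \<in> {0<..<1}. \<exists>N :: real \<Rightarrow> nat. \<exists>C > 0. \<exists>r > 0. \<forall>\<epsilon> \<in> {0<..\<epsilon>0}.
           N \<epsilon> \<ge> 1 \<and>
           Linf_norm {\<xi>..\<eta>} (\<lambda>x. \<phi> \<epsilon> x - \<phi>_WKB \<xi> \<eta> a (\<phi>0 \<epsilon>) (\<phi>1 \<epsilon>) (N \<epsilon>) \<epsilon> x)
             \<le> ereal (C * exp (- r / \<epsilon>))"
proof -
  obtain B \<kappa> D where "wkb_bounds \<xi> \<eta> a0 B \<kappa> a D"
    using hypothesis_A_imp_wkb_bounds[OF assms(1,2,3,6)] by blast
  then interpret wkb_bounds \<xi> \<eta> a0 B \<kappa> a D .
  define b where "b = 1 / (2 * \<kappa>)"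
  have b: "b > 0" using \<kappa> by (simp add: b_def)
  obtain N where N: "\<And>\<epsilon>. \<lbrakk>0 < \<epsilon>; \<epsilon> \<le> b / 2\<rbrakk> \<Longrightarrow>
      N \<epsilon> \<ge> 1 \<and> \<epsilon> * real (Suc (N \<epsilon>)) \<le> b \<and> b / \<epsilon> \<le> real (Suc (N \<epsilon>)) + 1"
    using exists_order_of_truncation[OF b] by blast
  \<comment> \<open>The three bounds ensure, in turn, \<open>\<epsilon> < 1\<close>, an admissible
    order \<open>N \<ge> 1\<close>, and amplitude denominators bounded away from 0.\<close>
  define \<epsilon>0 where "\<epsilon>0 = min (1 / 2) (min (b / 2) (sqrt a0 / (12 * B * \<kappa>)))"
  define r where "r = b * ln 2 / 2"
  define c where "c = (B + (b * B)\<^sup>2) * 54 / r ^ 3"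
  \<comment> \<open>The summand 1 keeps \<open>C\<close> positive also when \<open>M = 0\<close>
    makes \<open>error_const M\<close> vanish.\<close>
  define C where "C = error_const M * c + 1"
  have \<epsilon>0: "\<epsilon>0 \<in> {0<..<1}" using b B \<kappa> a0 by (auto simp: \<epsilon>0_def)
  have r: "r > 0" using b by (simp add: r_def)
  have "0 \<le> M" using order_trans[OF norm_ge_zero assms(4)[of "1 / 2"]] by simp
  then have M: "error_const M \<ge> 0"
    using B \<kappa> a0 \<xi>_less_\<eta> by (simp add: error_const_def)
  have c: "c \<ge> 0" using B r by (simp add: c_def)
  have C: "C > 0" using M c by (simp add: C_def add_nonneg_pos)
  have "N \<epsilon> \<ge> 1 \<and> Linf_norm {\<xi>..\<eta>} (\<lambda>x. \<phi> \<epsilon> x - \<phi>_WKB \<xi> \<eta> a (\<phi>0 \<epsilon>) (\<phi>1 \<epsilon>) (N \<epsilon>) \<epsilon> x)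
      \<le> ereal (C * exp (- r / \<epsilon>))" if \<epsilon>: "\<epsilon> \<in> {0<..\<epsilon>0}" for \<epsilon>
  proof
    have \<epsilon>1: "0 < \<epsilon>" "\<epsilon> \<le> 1" "\<epsilon> \<in> {0<..<1}" "\<epsilon> \<le> b / 2" "\<epsilon> \<le> sqrt a0 / (12 * B * \<kappa>)"
      using \<epsilon> by (auto simp: \<epsilon>0_def)
    note N\<epsilon> = N[OF \<epsilon>1(1,4)]
    show "N \<epsilon> \<ge> 1" using N\<epsilon> by blast
    have cond: "\<epsilon> * \<kappa> * real (Suc (N \<epsilon>)) \<le> 1 / 2" "12 * B * \<kappa> * \<epsilon> \<le> sqrt a0"
      using N\<epsilon> \<epsilon>1(5) B \<kappa> by (auto simp: b_def field_simps)
    note ivp = assms(7)[OF \<epsilon>1(3)]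
    show "Linf_norm {\<xi>..\<eta>} (\<lambda>x. \<phi> \<epsilon> x - \<phi>_WKB \<xi> \<eta> a (\<phi>0 \<epsilon>) (\<phi>1 \<epsilon>) (N \<epsilon>) \<epsilon> x)
      \<le> ereal (C * exp (- r / \<epsilon>))"
    proof (rule Linf_norm_le)
      have "continuous_on {\<xi>..\<eta>} (\<phi> \<epsilon>)"
        using ivp unfolding ivp_solution_def by (blast intro: continuous_on_vector_derivative)
      moreover have "continuous_on {\<xi>..\<eta>} (\<phi>_WKB \<xi> \<eta> a (\<phi>0 \<epsilon>) (\<phi>1 \<epsilon>) (N \<epsilon>) \<epsilon>)"
        by (rule continuous_on_vector_derivative[OF \<phi>_WKB_has_vector_derivative[OF _ \<epsilon>1(1)]])
      ultimately show "continuous_on {\<xi>..\<eta>} (\<lambda>x. \<phi> \<epsilon> x - \<phi>_WKB \<xi> \<eta> a (\<phi>0 \<epsilon>) (\<phi>1 \<epsilon>) (N \<epsilon>) \<epsilon> x)"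
        by (intro continuous_on_diff)
      fix x assume x: "x \<in> {\<xi>..\<eta>}"
      have "norm (\<phi> \<epsilon> x - \<phi>_WKB \<xi> \<eta> a (\<phi>0 \<epsilon>) (\<phi>1 \<epsilon>) (N \<epsilon>) \<epsilon> x)
          \<le> error_const M * ((B + (real (Suc (N \<epsilon>)) * B)\<^sup>2) * (1 / 2) ^ Suc (N \<epsilon>) / \<epsilon>)"
        by (intro norm_ivp_solution_minus_\<phi>_WKB_le[OF \<epsilon>1(1,2) cond ivp _ _ x] assms(4,5) \<epsilon>1(3))
      also have "\<dots> \<le> error_const M * (c * exp (- r / \<epsilon>))"
        unfolding c_def r_def using N\<epsilon>
        by (intro mult_left_mono M truncation_error_le b B \<epsilon>1(1,2)) auto
      also have "\<dots> \<le> C * exp (- r / \<epsilon>)" by (simp add: C_def algebra_simps)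
      finally show "norm (\<phi> \<epsilon> x - \<phi>_WKB \<xi> \<eta> a (\<phi>0 \<epsilon>) (\<phi>1 \<epsilon>) (N \<epsilon>) \<epsilon> x) \<le> C * exp (- r / \<epsilon>)" .
    qed
  qed
  with \<epsilon>0 C r show ?thesis by blast
qed

end
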